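(* Let $\{U_i\}_{i=1}^\infty$ be finite sets with $|U_1|<|U_2|<\cdots$, and let $\mathcal{H}_i$ be an $l$-hyperpartition of $U_i$ which is $\epsilon_i$-regular and $\delta_i$-equitable, where $\lim_{i}\epsilon_i=\lim_i\delta_i=0$. Let $\mathcal{C}$ be a combinatorial structure (an $S_k$-invariant set of functions $r([k])\to[l]$) and let $H_i$ be the union of the directed $\mathcal{H}_i$-cells with coordinates in $\mathcal{C}$. Then for every finite $k$-uniform hypergraph $F$, $\lim_{i\to\infty}t(F,H_i)=t(F,\mathcal{C})$.
   Context: A $k$-uniform hypergraph on a finite set $V$ is a subset of $V^k$ invariant under coordinate permutations with no repeated coordinates; $t(F,H)=\hom(F,H)/|V(H)|^{|V(F)|}$ with $\hom$ the number of maps $V(F)\to V(H)$ sending edges to edges. $r([k])$ is the set of nonempty subsets of $[k]$, $r([n],k)$ the nonempty subsets of $[n]$ of size $\le k$. For a finite set $X$, $K_r(X)\subseteq X^r$ is the set of $r$-tuples with distinct entries. An $l$-hyperpartition of $X$ is, for each $1\le r\le k$, a partition $K_r(X)=P^1_r\cup\dots\cup P^l_r$ into $r$-uniform hypergraphs; it is $\delta$-equitable if $\big||P^i_r|-|P^j_r|\big|/|K_r(X)|<\delta$ for all $r$, $i<j$. A cylinder intersection $L\subseteq K_r(X)$ is given by $(r-1)$-uniform hypergraphs $B_1,\dots,B_r$: $\{a_1,\dots,a_r\}\in L$ iff for some permutation $\sigma$ of $[r]$, $\{a_{\sigma(1)},\dots,a_{\sigma(r)}\}\setminus\{a_{\sigma(i)}\}\in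 B_i$ for all $i$. $G\subseteq K_r(X)$ is $\epsilon$-regular if $\big||G|/|K_r(X)|-|G\cap L|/|L|\big|\le\epsilon$ for all cylinder intersections $L$ with $|L|\ge\epsilon|K_r(X)|$; the hyperpartition is $\epsilon$-regular if all $P^j_r$ are. For $f:r([k])\to[l]$, the directed cell with coordinate $f$ is the set of $(x_1,\dots,x_k)\in K_k(X)$ with $\{x_i:i\in S\}\in P^{f(S)}_{|S|}$ for all $S\in r([k])$. $S_k$ acts on functions $r([k])\to[l]$ by $(\pi f)(S)=f(\pi^{-1}(S))$. For $F$ on $[n]$, $g:r([n],k)\to[l]$ is a homomorphism from $F$ to $\mathcal{C}$ if for every edge $E$ and bijection $s_E:[k]\to E$, $A\mapsto g(s_E(A))$ lies in $\mathcal{C}$; $t(F,\mathcal{C})$ is the probability that a uniformly random $g:r([n],k)\to[l]$ is a homomorphism. *)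

theory Defs
  imports
    "HOL-Analysis.Analysis"
    "HOL-Probability.Probability"
    "HOL-Combinatorics.Permutations"
begin

(* An r-tuple (x_1, ..., x_r) over X is an element of {1..r} \<rightarrow>\<^sub>E X, i.e. a function on
   {1..r} that takes the value undefined elsewhere; tuples are thus determined by their
   entries, and permuting coordinates is composition with a permutation of {1..r}. *)

definition distinct_tuples :: "nat \<Rightarrow> 'a set \<Rightarrow> (nat \<Rightarrow> 'a) set" where
  "distinct_tuples r X = {x \<in> {1..r} \<rightarrow>\<^sub>E X. inj_on x {1..r}}"

definition uniform_hypergraph :: "nat \<Rightarrow> 'a set \<Rightarrow> (nat \<Rightarrow> 'a) set \<Rightarrow> bool" where
  "uniform_hypergraph r X H \<longleftrightarrow>
     H \<subseteq> distinct_tuples r X \<and>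
     (\<forall>x\<in>H. \<forall>\<pi>. \<pi> permutes {1..r} \<longrightarrow> x \<circ> \<pi> \<in> H)"

(* By symmetry an r-uniform hypergraph is determined by its unordered edges, and
   "{a_1, ..., a_r} \<in> H" means membership in the following family. *)
definition edges :: "nat \<Rightarrow> (nat \<Rightarrow> 'a) set \<Rightarrow> 'a set set" where
  "edges r H = (\<lambda>x. x ` {1..r}) ` H"

definition homs ::
  "nat \<Rightarrow> 'b set \<Rightarrow> (nat \<Rightarrow> 'b) set \<Rightarrow> 'a set \<Rightarrow> (nat \<Rightarrow> 'a) set \<Rightarrow> ('b \<Rightarrow> 'a) set" where
  "homs k V F U H = {\<phi> \<in> V \<rightarrow>\<^sub>E U. \<forall>x\<in>F. compose {1..k} \<phi> x \<in> H}"

definition hom_density ::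
  "nat \<Rightarrow> 'b set \<Rightarrow> (nat \<Rightarrow> 'b) set \<Rightarrow> 'a set \<Rightarrow> (nat \<Rightarrow> 'a) set \<Rightarrow> real" where
  "hom_density k V F U H = real (card (homs k V F U H)) / real (card U) ^ card V"

(* r(V,k) for a finite vertex set V *)
definition small_subsets :: "'b set \<Rightarrow> nat \<Rightarrow> 'b set set" where
  "small_subsets V k = {S. S \<subseteq> V \<and> S \<noteq> {} \<and> card S \<le> k}"

abbreviation index_sets :: "nat \<Rightarrow> nat set set" where
  "index_sets k \<equiv> {S. S \<subseteq> {1..k} \<and> S \<noteq> {}}"

(* P r j is the j-th r-uniform part; parts may be empty *)
definition hyperpartition ::
  "nat \<Rightarrow> nat \<Rightarrow> 'a set \<Rightarrow> (nat \<Rightarrow> nat \<Rightarrow> (nat \<Rightarrow> 'a) set) \<Rightarrow> bool" where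
  "hyperpartition k l X P \<longleftrightarrow>
     (\<forall>r\<in>{1..k}.
        (\<forall>j\<in>{1..l}. uniform_hypergraph r X (P r j)) \<and>
        disjoint_family_on (P r) {1..l} \<and>
        (\<Union>j\<in>{1..l}. P r j) = distinct_tuples r X)"

definition equitable ::
  "nat \<Rightarrow> nat \<Rightarrow> 'a set \<Rightarrow> real \<Rightarrow> (nat \<Rightarrow> nat \<Rightarrow> (nat \<Rightarrow> 'a) set) \<Rightarrow> bool" where
  "equitable k l X \<delta> P \<longleftrightarrow>
     (\<forall>r\<in>{1..k}. \<forall>i\<in>{1..l}. \<forall>j\<in>{1..l}. i < j \<longrightarrow>
        \<bar>real (card (P r i)) - real (card (P r j))\<bar> / real (card (distinct_tuples r X)) < \<delta>)"

definition cylinder_of ::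
  "nat \<Rightarrow> 'a set \<Rightarrow> (nat \<Rightarrow> (nat \<Rightarrow> 'a) set) \<Rightarrow> (nat \<Rightarrow> 'a) set" where
  "cylinder_of r X B =
     {a \<in> distinct_tuples r X. \<exists>\<sigma>. \<sigma> permutes {1..r} \<and>
        (\<forall>i\<in>{1..r}. (\<lambda>m. a (\<sigma> m)) ` {1..r} - {a (\<sigma> i)} \<in> edges (r - 1) (B i))}"

definition cylinder_intersection :: "nat \<Rightarrow> 'a set \<Rightarrow> (nat \<Rightarrow> 'a) set \<Rightarrow> bool" where
  "cylinder_intersection r X L \<longleftrightarrow>
     (\<exists>B. (\<forall>i\<in>{1..r}. uniform_hypergraph (r - 1) X (B i)) \<and> L = cylinder_of r X B)"

(* The condition L \<noteq> {} only excludes a zero denominator; it is automatic if \<epsilon> > 0 and X has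
   at least r elements. *)
definition regular_in :: "nat \<Rightarrow> 'a set \<Rightarrow> real \<Rightarrow> (nat \<Rightarrow> 'a) set \<Rightarrow> bool" where
  "regular_in r X \<epsilon> G \<longleftrightarrow>
     (\<forall>L. cylinder_intersection r X L \<and> L \<noteq> {} \<and>
          real (card L) \<ge> \<epsilon> * real (card (distinct_tuples r X)) \<longrightarrow>
        \<bar>real (card G) / real (card (distinct_tuples r X))
           - real (card (G \<inter> L)) / real (card L)\<bar> \<le> \<epsilon>)"

definition regular_hyperpartition ::
  "nat \<Rightarrow> nat \<Rightarrow> 'a set \<Rightarrow> real \<Rightarrow> (nat \<Rightarrow> nat \<Rightarrow> (nat \<Rightarrow> 'a) set) \<Rightarrow> bool" where
  "regular_hyperpartition k l X \<epsilon> P \<longleftrightarrow>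
     (\<forall>r\<in>{1..k}. \<forall>j\<in>{1..l}. regular_in r X \<epsilon> (P r j))"

definition directed_cell ::
  "nat \<Rightarrow> 'a set \<Rightarrow> (nat \<Rightarrow> nat \<Rightarrow> (nat \<Rightarrow> 'a) set) \<Rightarrow> (nat set \<Rightarrow> nat) \<Rightarrow> (nat \<Rightarrow> 'a) set" where
  "directed_cell k X P f =
     {x \<in> distinct_tuples k X. \<forall>S\<in>index_sets k. x ` S \<in> edges (card S) (P (card S) (f S))}"

definition combinatorial_structure :: "nat \<Rightarrow> nat \<Rightarrow> (nat set \<Rightarrow> nat) set \<Rightarrow> bool" where
  "combinatorial_structure k l C \<longleftrightarrow>
     C \<subseteq> (index_sets k \<rightarrow>\<^sub>E {1..l}) \<and>
     (\<forall>f\<in>C. \<forall>\<pi>. \<pi> permutes {1..k} \<longrightarrow> (\<lambda>S\<in>index_sets k. f (inv \<pi> ` S)) \<in> C)"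

definition cell_union ::
  "nat \<Rightarrow> 'a set \<Rightarrow> (nat \<Rightarrow> nat \<Rightarrow> (nat \<Rightarrow> 'a) set) \<Rightarrow> (nat set \<Rightarrow> nat) set \<Rightarrow> (nat \<Rightarrow> 'a) set" where
  "cell_union k X P C = (\<Union>f\<in>C. directed_cell k X P f)"

definition structure_hom ::
  "nat \<Rightarrow> (nat \<Rightarrow> 'b) set \<Rightarrow> (nat set \<Rightarrow> nat) set \<Rightarrow> ('b set \<Rightarrow> nat) \<Rightarrow> bool" where
  "structure_hom k F C g \<longleftrightarrow>
     (\<forall>E\<in>edges k F. \<forall>s. bij_betw s {1..k} E \<longrightarrow> (\<lambda>A\<in>index_sets k. g (s ` A)) \<in> C)"

definition structure_density ::
  "nat \<Rightarrow> nat \<Rightarrow> 'b set \<Rightarrow> (nat \<Rightarrow> 'b) set \<Rightarrow> (nat set \<Rightarrow> nat) set \<Rightarrow> real" where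
  "structure_density k l V F C =
     measure_pmf.prob (pmf_of_set (small_subsets V k \<rightarrow>\<^sub>E {1..l})) {g. structure_hom k F C g}"

end

theory Submission
  imports Defs
begin

text \<open>
  Up to non-injective maps, a map \<open>\<phi> : V \<rightarrow> U\<close> colours every small subset \<open>T\<close> of \<open>V\<close> by the part
  containing \<open>\<phi> ` T\<close>, and it is a homomorphism into the cell union iff this colouring is a
  homomorphism into \<open>C\<close>. So it suffices that every colouring occurs with limiting probability
  \<open>(1/l) ^ card (small_subsets V k)\<close>. Conditions on small subsets are removed one at a time, largest
  first: if \<open>S\<close> is the largest, then for a fixed restriction of \<open>\<phi>\<close> to \<open>V - S\<close> each other condition
  ignores the value of \<open>\<phi>\<close> at some point of \<open>S\<close>, so that regularity makes the condition on \<open>S\<close>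
  asymptotically independent of the others, and equitability gives it density \<open>1/l\<close>.

  These conditions depend on the order of the tuple, whereas cylinder intersections are symmetric.
  To compare the two, restrict to tuples with \<open>c (x i) = i\<close> for a colouring \<open>c : X \<rightarrow> {1..r}\<close>, where
  every edge has at most one admissible ordering, and average over all \<open>c\<close>.
\<close>

section \<open>Tuples, their unordered edges, and permutations of coordinates\<close>

lemma finite_distinct_tuples: "finite X \<Longrightarrow> finite (distinct_tuples r X)"
  by (rule finite_subset[of _ "{1..r} \<rightarrow>\<^sub>E X"]) (auto simp: distinct_tuples_def finite_PiE)

text \<open>Two injective tuples with the same range differ by a permutation of coordinates, and
  \<open>G\<close> is closed under such permutations. This allows free passage between ordered and
  unordered membership.\<close>

lemma image_in_edges_iff:
  assumes "uniform_hypergraph r X G" "x \<in> distinct_tuples r X"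
  shows "x ` {1..r} \<in> edges r G \<longleftrightarrow> x \<in> G"
proof
  assume "x ` {1..r} \<in> edges r G"
  then obtain y where y: "y \<in> G" "x ` {1..r} = y ` {1..r}"
    unfolding edges_def by blast
  have yK: "y \<in> distinct_tuples r X"
    using assms(1) y(1) unfolding uniform_hypergraph_def by blast
  define I where "I = {1..r}"
  have x: "x \<in> I \<rightarrow>\<^sub>E X" "inj_on x I" and y': "y \<in> I \<rightarrow>\<^sub>E X" "inj_on y I"
    using assms(2) yK unfolding distinct_tuples_def I_def by blast+
  have bx: "bij_betw x I (y ` I)" and by': "bij_betw y I (y ` I)"
    using x(2) y'(2) y(2) unfolding bij_betw_def I_def by blast+
  \<comment> \<open>The permutation with \<open>y \<circ> \<pi> = x\<close>. The identity outside
    \<open>I\<close> makes it a permutation of \<open>I\<close> in the sense of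
    \<open>permutes\<close>; there both tuples are \<open>undefined\<close>, so the equation holds
    everywhere.\<close>
  define \<pi> where "\<pi> i = (if i \<in> I then inv_into I y (x i) else i)" for i
  have "bij_betw (inv_into I y \<circ> x) I I"
    using bij_betw_trans[OF bx bij_betw_inv_into[OF by']] .
  moreover have "bij_betw \<pi> I I \<longleftrightarrow> bij_betw (inv_into I y \<circ> x) I I"
    by (rule bij_betw_cong) (simp add: \<pi>_def)
  ultimately have "\<pi> permutes I"
    by (intro bij_imp_permutes) (simp_all add: \<pi>_def)
  then have "y \<circ> \<pi> \<in> G"
    using assms(1) y(1) unfolding uniform_hypergraph_def I_def by blast
  moreover have "y \<circ> \<pi> = x"
  proof
    fix i
    show "(y \<circ> \<pi>) i = x i"
    proof (cases "i \<in> I")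
      case True
      then have "x i \<in> y ` I" using y(2) unfolding I_def by blast
      then show ?thesis using True by (simp add: \<pi>_def f_inv_into_f)
    next
      case False
      then show ?thesis using PiE_arb[OF x(1) False] PiE_arb[OF y'(1) False] by (simp add: \<pi>_def)
    qed
  qed
  ultimately show "x \<in> G" by simp
next
  assume "x \<in> G" then show "x ` {1..r} \<in> edges r G"
    unfolding edges_def by blast
qed

text \<open>Any finite set of size \<open>r\<close> can be enumerated by \<open>{1..r}\<close>.
  Hence a hypergraph may be prescribed by an arbitrary predicate on unordered sets, which is how the
  hypergraphs defining a cylinder intersection are built below.\<close>

lemma edges_of_set_property:
  "edges r {y \<in> distinct_tuples r X. R (y ` {1..r})} = {E. E \<subseteq> X \<and> finite E \<and> card E = r \<and> R E}"
proof (intro set_eqI iffI)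
  fix E assume "E \<in> {E. E \<subseteq> X \<and> finite E \<and> card E = r \<and> R E}"
  then have E: "E \<subseteq> X" "finite E" "card E = r" "R E" by auto
  then obtain h where h: "bij_betw h {1..r} E"
    using ex_bij_betw_nat_finite_1 by blast
  have im: "restrict h {1..r} ` {1..r} = E"
    using bij_betw_imp_surj_on[OF h] by (simp only: image_restrict_eq)
  have "inj_on (restrict h {1..r}) {1..r}"
    using bij_betw_imp_inj_on[OF h] by (simp only: inj_on_restrict_eq)
  moreover have "restrict h {1..r} \<in> {1..r} \<rightarrow>\<^sub>E X"
    using bij_betwE[OF h] E(1) by (simp add: subset_iff)
  ultimately have "restrict h {1..r} \<in> distinct_tuples r X"
    by (simp add: distinct_tuples_def)
  then show "E \<in> edges r {y \<in> distinct_tuples r X. R (y ` {1..r})}"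
    unfolding edges_def using im E(4) by blast
next
  fix E assume "E \<in> edges r {y \<in> distinct_tuples r X. R (y ` {1..r})}"
  then obtain y where y: "y \<in> {1..r} \<rightarrow>\<^sub>E X" "inj_on y {1..r}" "R (y ` {1..r})" "E = y ` {1..r}"
    unfolding edges_def distinct_tuples_def by blast
  moreover have "y ` {1..r} \<subseteq> X" using y(1) by (metis PiE_mem image_subsetI)
  ultimately show "E \<in> {E. E \<subseteq> X \<and> finite E \<and> card E = r \<and> R E}"
    by (simp add: card_image)
qed

lemma distinct_tuples_permute:
  assumes "\<sigma> permutes {1..r}"
  shows "x \<circ> \<sigma> \<in> distinct_tuples r X \<longleftrightarrow> x \<in> distinct_tuples r X"
proof -
  have *: "y \<circ> \<tau> \<in> distinct_tuples r X"
    if "y \<in> distinct_tuples r X" and t: "\<tau> permutes {1..r}" for y \<tau>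
  proof -
    have "inj_on (y \<circ> \<tau>) {1..r}"
      using that(1) permutes_inj_on[OF t, of "{1..r}"] permutes_image[OF t]
      unfolding distinct_tuples_def by (metis (no_types, lifting) comp_inj_on mem_Collect_eq)
    moreover have "y \<circ> \<tau> \<in> {1..r} \<rightarrow>\<^sub>E X"
    proof (rule PiE_I)
      fix i assume "i \<in> {1..r}"
      then show "(y \<circ> \<tau>) i \<in> X"
        using that permutes_in_image[OF t, of i] unfolding distinct_tuples_def
        by (metis (no_types, lifting) PiE_mem comp_apply mem_Collect_eq)
    next
      fix i assume "i \<notin> {1..r}"
      then show "(y \<circ> \<tau>) i = undefined"
        using that permutes_not_in[OF t, of i] unfolding distinct_tuples_def
        by (metis (no_types, lifting) PiE_arb comp_apply mem_Collect_eq)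
    qed
    ultimately show ?thesis by (simp add: distinct_tuples_def)
  qed
  have "(x \<circ> \<sigma>) \<circ> inv \<sigma> = x"
    by (simp only: comp_assoc permutes_inv_o(1)[OF assms] comp_id)
  then show ?thesis
    using *[OF _ assms, of x] *[OF _ permutes_inv[OF assms], of "x \<circ> \<sigma>"] by metis
qed

lemma uniform_hypergraph_of_set_property:
  "uniform_hypergraph r X {y \<in> distinct_tuples r X. R (y ` {1..r})}"
proof -
  have "(y \<circ> \<pi>) ` {1..r} = y ` {1..r}" if "\<pi> permutes {1..r}" for y :: "nat \<Rightarrow> 'a" and \<pi>
    using permutes_image[OF that] by (metis image_comp)
  then show ?thesis
    unfolding uniform_hypergraph_def
    by (simp add: distinct_tuples_permute)
qed

section \<open>Regularity tested on cylinder intersections and on correctly coloured tuples\<close>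

text \<open>Multiplying the regularity inequality by \<open>card L\<close> clears the denominator
  and also absorbs the size threshold: a cylinder intersection below the threshold has discrepancy
  at most its own size. The absolute value appears because no sign is assumed for
  \<open>\<epsilon>\<close>.\<close>

lemma regular_cylinder_discrepancy:
  assumes "finite X" "G \<subseteq> distinct_tuples r X" "regular_in r X \<epsilon> G" "cylinder_intersection r X L"
  shows "\<bar>real (card (G \<inter> L)) - real (card G) / real (card (distinct_tuples r X)) * real (card L)\<bar>
    \<le> \<bar>\<epsilon>\<bar> * real (card (distinct_tuples r X))"
proof -
  let ?K = "distinct_tuples r X"
  have LK: "L \<subseteq> ?K"
    using assms(4) by (auto simp: cylinder_intersection_def cylinder_of_def)
  have finK: "finite ?K" using assms(1) by (rule finite_distinct_tuples)
  have finL: "finite L" using LK finK by (rule finite_subset)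
  have cLK: "card L \<le> card ?K" using LK finK by (simp add: card_mono)
  define p where "p = real (card G) / real (card ?K)"
  have p0: "0 \<le> p" by (simp add: p_def)
  show ?thesis
  proof (cases "L \<noteq> {} \<and> real (card L) \<ge> \<epsilon> * real (card ?K)")
    case True
    then have c0: "real (card L) > 0" using finL by (simp add: card_gt_0_iff)
    have "\<bar>p - real (card (G \<inter> L)) / real (card L)\<bar> \<le> \<epsilon>"
      using assms(3,4) True unfolding regular_in_def p_def by blast
    then have "\<bar>p - real (card (G \<inter> L)) / real (card L)\<bar> * real (card L) \<le> \<bar>\<epsilon>\<bar> * real (card ?K)"
      using cLK by (intro mult_mono) auto
    also have "\<bar>p - real (card (G \<inter> L)) / real (card L)\<bar> * real (card L)
        = \<bar>(p - real (card (G \<inter> L)) / real (card L)) * real (card L)\<bar>"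
      by (simp add: abs_mult)
    also have "(p - real (card (G \<inter> L)) / real (card L)) * real (card L)
        = p * real (card L) - real (card (G \<inter> L))"
      using c0 by (simp add: left_diff_distrib)
    finally show ?thesis unfolding p_def by linarith
  next
    case False
    have p01: "0 \<le> p * real (card L)" by (simp add: p_def)
    show ?thesis
    proof (cases "L = {}")
      case True then show ?thesis by simp
    next
      case ne: False
      with False have less: "real (card L) < \<epsilon> * real (card ?K)" by auto
      also have "\<dots> \<le> \<bar>\<epsilon>\<bar> * real (card ?K)" by (intro mult_right_mono) auto
      finally have b: "real (card L) \<le> \<bar>\<epsilon>\<bar> * real (card ?K)" by simp
      \<comment> \<open>Both \<open>card (G \<inter> L)\<close> and \<open>p * card L\<close> lie
        between \<open>0\<close> and \<open>card L\<close>, so they differ by at most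
        \<open>card L\<close>, which is below the threshold.\<close>
      have i: "card (G \<inter> L) \<le> card L" using finL by (simp add: card_mono)
      have "p \<le> 1" using finK assms(2)
        by (simp add: p_def divide_le_eq_1 card_mono card_gt_0_iff)
      then have "p * real (card L) \<le> real (card L)" using p0 by (intro mult_left_le_one_le) auto
      then show ?thesis using b i p01 unfolding p_def by linarith
    qed
  qed
qed

text \<open>
  For \<open>r = 1\<close> this fails: the only nonempty cylinder intersection is the whole vertex set, which
  is why \<open>ordered_discrepancy\<close> treats that case separately.
\<close>
lemma cylinder_intersection_transversal:
  fixes c :: "'a \<Rightarrow> nat"
  assumes r: "2 \<le> r"
    and local: "\<And>i x y. i \<in> {1..r} \<Longrightarrow> (\<And>j. j \<in> {1..r} - {i} \<Longrightarrow> x j = y j) \<Longrightarrow> Q i x = Q i y"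
  shows "cylinder_intersection r X {a \<in> distinct_tuples r X. \<exists>\<sigma>. \<sigma> permutes {1..r} \<and>
    (\<forall>i\<in>{1..r}. c (a (\<sigma> i)) = i \<and> Q i (a \<circ> \<sigma>))}"
proof -
  define I where "I = {1..r}"
  have finI: "finite I" by (simp add: I_def)
  \<comment> \<open>Here \<open>2 \<le> r\<close> enters: every coordinate survives the deletion of
    some other coordinate, so its colour is tested by one of the hypergraphs
    \<open>B i\<close>.\<close>
  have other: "\<exists>i'\<in>I. i' \<noteq> i" for i
    using r unfolding I_def by (intro bexI[of _ "if i = 1 then 2 else 1"]) auto
  \<comment> \<open>\<open>R i E\<close> says that \<open>E\<close> can be listed along
    \<open>I - {i}\<close> with matching colours so that \<open>Q i\<close> holds. The value of the
    witness \<open>x\<close> at \<open>i\<close> is arbitrary, which is legitimate because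
    \<open>Q i\<close> ignores it.\<close>
  define R where "R i E \<longleftrightarrow> (\<exists>x. E = x ` (I - {i}) \<and> (\<forall>j\<in>I - {i}. c (x j) = j) \<and> Q i x)"
    for i and E :: "'a set"
  define B where "B i = {y \<in> distinct_tuples (r - 1) X. R i (y ` {1..r - 1})}" for i
  have cyl: "a \<in> cylinder_of r X B \<longleftrightarrow> (\<exists>\<sigma>. \<sigma> permutes I \<and> (\<forall>i\<in>I. c (a (\<sigma> i)) = i \<and> Q i (a \<circ> \<sigma>)))"
    if a: "a \<in> distinct_tuples r X" for a
  proof -
    have "(\<forall>i\<in>I. (\<lambda>m. a (\<sigma> m)) ` I - {a (\<sigma> i)} \<in> edges (r - 1) (B i))
        \<longleftrightarrow> (\<forall>i\<in>I. c (a (\<sigma> i)) = i \<and> Q i (a \<circ> \<sigma>))" if \<sigma>: "\<sigma> permutes I" for \<sigma>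
    proof -
      define x where "x = a \<circ> \<sigma>"
      have "x \<in> distinct_tuples r X"
        using a \<sigma> unfolding x_def I_def by (simp add: distinct_tuples_permute)
      then have x: "x \<in> I \<rightarrow>\<^sub>E X" "inj_on x I"
        unfolding distinct_tuples_def I_def by blast+
      have xi: "x ` I - {x i} = x ` (I - {i})" if "i \<in> I" for i
        using inj_on_image_set_diff[OF x(2), of I "{i}"] that by simp
      have props: "x ` (I - {i}) \<subseteq> X" "finite (x ` (I - {i}))" "card (x ` (I - {i})) = r - 1"
        if "i \<in> I" for i
      proof -
        show "x ` (I - {i}) \<subseteq> X" using PiE_mem[OF x(1)] by blast
        have "inj_on x (I - {i})" using x(2) by (rule inj_on_subset) blast
        then show "card (x ` (I - {i})) = r - 1"
          using that finI by (simp add: card_image card_Diff_singleton I_def)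
      qed (simp add: finI)
      have "(\<forall>i\<in>I. x ` I - {x i} \<in> edges (r - 1) (B i)) \<longleftrightarrow> (\<forall>i\<in>I. R i (x ` (I - {i})))"
        unfolding B_def edges_of_set_property using xi props by simp
      also have "\<dots> \<longleftrightarrow> (\<forall>i\<in>I. c (x i) = i \<and> Q i x)"
      proof
        assume "\<forall>i\<in>I. c (x i) = i \<and> Q i x"
        then show "\<forall>i\<in>I. R i (x ` (I - {i}))" unfolding R_def by blast
      next
        assume "\<forall>i\<in>I. R i (x ` (I - {i}))"
        then have "\<forall>i\<in>I. \<exists>y. x ` (I - {i}) = y ` (I - {i}) \<and> (\<forall>j\<in>I - {i}. c (y j) = j) \<and> Q i y"
          unfolding R_def .
        then obtain z where z: "\<And>i. i \<in> I \<Longrightarrow> x ` (I - {i}) = z i ` (I - {i})"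
            "\<And>i j. i \<in> I \<Longrightarrow> j \<in> I - {i} \<Longrightarrow> c (z i j) = j" "\<And>i. i \<in> I \<Longrightarrow> Q i (z i)"
          by metis
        \<comment> \<open>Deleting coordinate \<open>i\<close> leaves exactly the colours other than
          \<open>i\<close>. Varying \<open>i\<close> shows that \<open>c \<circ> x\<close> maps
          \<open>I\<close> onto \<open>I\<close>, hence injectively, so \<open>x i\<close> must
          carry the missing colour \<open>i\<close>.\<close>
        have lab: "(c \<circ> x) ` (I - {i}) = I - {i}" if "i \<in> I" for i
        proof -
          have "(c \<circ> x) ` (I - {i}) = (\<lambda>j. c (z i j)) ` (I - {i})"
            using z(1)[OF that] by (metis image_comp image_image)
          also have "\<dots> = (\<lambda>j. j) ` (I - {i})"
            using z(2)[OF that] by (intro image_cong) auto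
          finally show ?thesis by simp
        qed
        have "i \<in> (c \<circ> x) ` I" if "i \<in> I" for i
        proof -
          obtain i' where "i' \<in> I" "i' \<noteq> i"
            using that other by blast
          then show ?thesis using lab[of i'] that by blast
        qed
        moreover have "(c \<circ> x) ` I \<subseteq> I"
        proof
          fix m assume "m \<in> (c \<circ> x) ` I"
          then obtain j where j: "j \<in> I" "m = (c \<circ> x) j" by blast
          obtain i where "i \<in> I" "i \<noteq> j"
            using j(1) other by blast
          then show "m \<in> I" using lab[of i] j by blast
        qed
        ultimately have surj: "(c \<circ> x) ` I = I" by blast
        then have inj: "inj_on (c \<circ> x) I" using finI by (simp add: eq_card_imp_inj_on)
        have cx: "c (x i) = i" if "i \<in> I" for i
        proof (rule ccontr)
          assume "c (x i) \<noteq> i"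
          moreover have "c (x i) \<in> I" using surj that by force
          ultimately have "c (x i) \<in> (c \<circ> x) ` (I - {i})" using lab[OF that] by simp
          then obtain j where j: "j \<in> I" "j \<noteq> i" "(c \<circ> x) j = (c \<circ> x) i" by force
          then show False using inj_onD[OF inj j(3,1) that] by simp
        qed
        have "Q i x" if i: "i \<in> I" for i
        proof -
          \<comment> \<open>Colours determine positions: \<open>z i j\<close> equals some
            \<open>x m\<close>, whose colour is both \<open>m\<close> and \<open>j\<close>. Thus the
            witness for \<open>R i\<close> agrees with \<open>x\<close> off \<open>i\<close>, and
            \<open>local\<close> transfers \<open>Q i\<close> to \<open>x\<close>.\<close>
          have "z i j = x j" if j: "j \<in> I - {i}" for j
          proof -
            have "z i j \<in> x ` (I - {i})" using z(1)[OF i] j by blast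
            then obtain m where "m \<in> I" "z i j = x m" by blast
            then show ?thesis using cx[of m] z(2)[OF i j] by simp
          qed
          then show ?thesis using local[of i "z i" x] z(3)[OF i] i unfolding I_def by blast
        qed
        with cx show "\<forall>i\<in>I. c (x i) = i \<and> Q i x" by blast
      qed
      finally show ?thesis unfolding x_def comp_def .
    qed
    then show ?thesis
      using a unfolding cylinder_of_def I_def[symmetric] by blast
  qed
  have "{a \<in> distinct_tuples r X. \<exists>\<sigma>. \<sigma> permutes I \<and> (\<forall>i\<in>I. c (a (\<sigma> i)) = i \<and> Q i (a \<circ> \<sigma>))} = cylinder_of r X B"
    using cyl by (auto simp: cylinder_of_def)
  moreover have "\<forall>i\<in>I. uniform_hypergraph (r - 1) X (B i)"
    unfolding B_def using uniform_hypergraph_of_set_property by blast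
  ultimately show ?thesis
    unfolding cylinder_intersection_def I_def by blast
qed

text \<open>The map sending \<open>(x, \<pi>)\<close> to \<open>x \<circ> \<pi>\<close> is a
  bijection from correctly coloured tuples paired with permutations: the colour of the
  \<open>i\<close>-th entry of \<open>x \<circ> \<pi>\<close> is \<open>\<pi> i\<close>, so the
  permutation, and then \<open>x\<close>, can be recovered. Each ordered solution therefore accounts
  for \<open>r!\<close> tuples of the symmetric set.\<close>

lemma card_symmetrization:
  fixes c :: "'a \<Rightarrow> nat"
  assumes fin: "finite X" and G: "uniform_hypergraph r X G"
  shows "card (G \<inter> {a \<in> distinct_tuples r X. \<exists>\<sigma>. \<sigma> permutes {1..r} \<and>
      (\<forall>i\<in>{1..r}. c (a (\<sigma> i)) = i \<and> Q i (a \<circ> \<sigma>))})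
    = fact r * card {x \<in> G. \<forall>i\<in>{1..r}. c (x i) = i \<and> Q i x}" (is "card ?L = _ * card ?W")
proof -
  let ?Pm = "{\<pi>. \<pi> permutes {1..r}}"
  have GK: "G \<subseteq> distinct_tuples r X" and sym: "\<And>x \<pi>. x \<in> G \<Longrightarrow> \<pi> permutes {1..r} \<Longrightarrow> x \<circ> \<pi> \<in> G"
    using G unfolding uniform_hypergraph_def by blast+
  have "bij_betw (\<lambda>(x, \<pi>). x \<circ> \<pi>) (?W \<times> ?Pm) ?L"
  proof (rule bij_betwI')
    fix p q assume p: "p \<in> ?W \<times> ?Pm" and q: "q \<in> ?W \<times> ?Pm"
    obtain x \<pi> y \<rho> where pq: "p = (x, \<pi>)" "q = (y, \<rho>)" by (cases p, cases q) auto
    have x: "\<And>i. i \<in> {1..r} \<Longrightarrow> c (x i) = i" and y: "\<And>i. i \<in> {1..r} \<Longrightarrow> c (y i) = i"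
      and \<pi>: "\<pi> permutes {1..r}" and \<rho>: "\<rho> permutes {1..r}"
      using p q pq by blast+
    have "p = q" if eq: "x \<circ> \<pi> = y \<circ> \<rho>"
    proof -
      have "\<pi> = \<rho>"
      proof
        fix i show "\<pi> i = \<rho> i"
        proof (cases "i \<in> {1..r}")
          case True
          then have "\<pi> i \<in> {1..r}" "\<rho> i \<in> {1..r}"
            using permutes_in_image[OF \<pi>] permutes_in_image[OF \<rho>] by blast+
          then have "c (x (\<pi> i)) = \<pi> i" "c (y (\<rho> i)) = \<rho> i" using x y by blast+
          then show ?thesis using fun_cong[OF eq, of i] by simp
        next
          case False
          then show ?thesis using permutes_not_in[OF \<pi>] permutes_not_in[OF \<rho>] by metis
        qed
      qed
      moreover have "x = y"
      proof
        fix i show "x i = y i"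
          using fun_cong[OF eq, of "inv \<rho> i"] permutes_inverses(1)[OF \<rho>, of i]
          unfolding \<open>\<pi> = \<rho>\<close> by simp
      qed
      ultimately show ?thesis using pq by blast
    qed
    then show "(case p of (x, \<pi>) \<Rightarrow> x \<circ> \<pi>) = (case q of (x, \<pi>) \<Rightarrow> x \<circ> \<pi>) \<longleftrightarrow> p = q"
      unfolding pq prod.case by blast
  next
    fix p assume "p \<in> ?W \<times> ?Pm"
    then obtain x \<pi> where p: "p = (x, \<pi>)" "x \<in> ?W" "\<pi> permutes {1..r}" by blast
    have inv: "(x \<circ> \<pi>) \<circ> inv \<pi> = x"
      by (simp only: comp_assoc permutes_inv_o(1)[OF p(3)] comp_id)
    have "x \<circ> \<pi> \<in> G" using p sym by blast
    moreover have "inv \<pi> permutes {1..r} \<and> (\<forall>i\<in>{1..r}. c ((x \<circ> \<pi>) (inv \<pi> i)) = i \<and> Q i ((x \<circ> \<pi>) \<circ> inv \<pi>))"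
      using p(2) permutes_inv[OF p(3)] by (simp add: inv permutes_inverses(1)[OF p(3)])
    ultimately have "x \<circ> \<pi> \<in> ?L" using GK by blast
    then show "(case p of (x, \<pi>) \<Rightarrow> x \<circ> \<pi>) \<in> ?L" using p by simp
  next
    fix a assume "a \<in> ?L"
    then obtain \<sigma> where a: "a \<in> G" and \<sigma>: "\<sigma> permutes {1..r}"
      and W: "\<forall>i\<in>{1..r}. c (a (\<sigma> i)) = i \<and> Q i (a \<circ> \<sigma>)" by blast
    have "a \<circ> \<sigma> \<in> ?W" using a \<sigma> W sym by simp
    then have "(a \<circ> \<sigma>, inv \<sigma>) \<in> ?W \<times> ?Pm" using permutes_inv[OF \<sigma>] by simp
    moreover have "a = (case (a \<circ> \<sigma>, inv \<sigma>) of (x, \<pi>) \<Rightarrow> x \<circ> \<pi>)"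
      by (simp only: prod.case comp_assoc permutes_inv_o(1)[OF \<sigma>] comp_id)
    ultimately show "\<exists>p\<in>?W \<times> ?Pm. a = (case p of (x, \<pi>) \<Rightarrow> x \<circ> \<pi>)" by (rule rev_bexI)
  qed
  then have "card ?L = card (?W \<times> ?Pm)" by (rule bij_betw_same_card[symmetric])
  also have "\<dots> = card ?W * fact r"
    unfolding card_cartesian_product by (subst card_permutations[of "{1..r}" r]) simp_all
  finally show ?thesis by (simp only: mult.commute)
qed

lemma uniform_hypergraph_distinct_tuples: "uniform_hypergraph r X (distinct_tuples r X)"
  by (simp add: uniform_hypergraph_def distinct_tuples_permute)

text \<open>Symmetrization, applied to \<open>G\<close> and to the complete hypergraph, multiplies
  both counts by \<open>r!\<close> and turns them into counts in a cylinder intersection, where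
  regularity applies.\<close>

lemma transversal_discrepancy:
  fixes c :: "'a \<Rightarrow> nat"
  assumes "2 \<le> r" "finite X" "uniform_hypergraph r X G" "regular_in r X \<epsilon> G"
    and local: "\<And>i x y. i \<in> {1..r} \<Longrightarrow> (\<And>j. j \<in> {1..r} - {i} \<Longrightarrow> x j = y j) \<Longrightarrow> Q i x = Q i y"
  shows "\<bar>real (card {x \<in> G. \<forall>i\<in>{1..r}. c (x i) = i \<and> Q i x})
      - real (card G) / real (card (distinct_tuples r X))
        * real (card {x \<in> distinct_tuples r X. \<forall>i\<in>{1..r}. c (x i) = i \<and> Q i x})\<bar>
    \<le> \<bar>\<epsilon>\<bar> * real (card (distinct_tuples r X))"
proof -
  let ?K = "distinct_tuples r X"
  define L where "L = {a \<in> ?K. \<exists>\<sigma>. \<sigma> permutes {1..r} \<and>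
    (\<forall>i\<in>{1..r}. c (a (\<sigma> i)) = i \<and> Q i (a \<circ> \<sigma>))}"
  define W where "W H = {x \<in> H. \<forall>i\<in>{1..r}. c (x i) = i \<and> Q i x}" for H
  define p where "p = real (card G) / real (card ?K)"
  have GK: "G \<subseteq> ?K" using assms(3) unfolding uniform_hypergraph_def by blast
  have cyl: "cylinder_intersection r X L"
    unfolding L_def by (rule cylinder_intersection_transversal[where Q = Q and c = c, OF assms(1) local])
  have cG: "card (G \<inter> L) = fact r * card (W G)"
    unfolding L_def W_def by (rule card_symmetrization[where Q = Q and c = c, OF assms(2,3)])
  have "card (?K \<inter> L) = fact r * card (W ?K)"
    unfolding L_def W_def
    by (rule card_symmetrization[where Q = Q and c = c, OF assms(2) uniform_hypergraph_distinct_tuples])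
  moreover have "?K \<inter> L = L" unfolding L_def by blast
  ultimately have cL: "card L = fact r * card (W ?K)" by simp
  \<comment> \<open>The common factor \<open>r!\<close> is at least \<open>1\<close>, so it is
    simply discarded; a sharper constant would bring nothing in the limit.\<close>
  have "1 * \<bar>real (card (W G)) - p * real (card (W ?K))\<bar>
      \<le> fact r * \<bar>real (card (W G)) - p * real (card (W ?K))\<bar>"
    by (intro mult_right_mono fact_ge_1) simp
  also have "\<dots> = \<bar>fact r * (real (card (W G)) - p * real (card (W ?K)))\<bar>"
    by (simp add: abs_mult)
  also have "\<dots> = \<bar>real (card (G \<inter> L)) - p * real (card L)\<bar>"
    by (simp add: cG cL algebra_simps)
  also have "\<dots> \<le> \<bar>\<epsilon>\<bar> * real (card ?K)"
    unfolding p_def by (rule regular_cylinder_discrepancy[OF assms(2) GK assms(4) cyl])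
  finally show ?thesis unfolding W_def p_def by simp
qed

section \<open>Averaging over colourings to remove the colour condition\<close>

text \<open>The colours of the \<open>r\<close> distinct entries are forced and all other points are
  coloured freely, so the number does not depend on the tuple.\<close>

lemma card_compatible_colourings:
  assumes "finite X" "x \<in> distinct_tuples r X"
  shows "card {c \<in> X \<rightarrow>\<^sub>E {1..r}. \<forall>i\<in>{1..r}. c (x i) = i} = r ^ (card X - r)"
proof -
  define I where "I = {1..r}"
  have x: "x \<in> I \<rightarrow>\<^sub>E X" "inj_on x I"
    using assms(2) unfolding distinct_tuples_def I_def by blast+
  have sub: "x ` I \<subseteq> X" using PiE_mem[OF x(1)] by blast
  have c: "card (x ` I) = r" using x(2) by (simp add: card_image I_def)
  have "{c \<in> X \<rightarrow>\<^sub>E I. \<forall>i\<in>I. c (x i) = i}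
      = (\<Pi>\<^sub>E v\<in>X. if v \<in> x ` I then {inv_into I x v} else I)"
  proof (intro set_eqI iffI)
    fix d assume "d \<in> {c \<in> X \<rightarrow>\<^sub>E I. \<forall>i\<in>I. c (x i) = i}"
    then have d: "d \<in> X \<rightarrow>\<^sub>E I" "\<And>i. i \<in> I \<Longrightarrow> d (x i) = i" by blast+
    show "d \<in> (\<Pi>\<^sub>E v\<in>X. if v \<in> x ` I then {inv_into I x v} else I)"
    proof (rule PiE_I)
      fix v assume "v \<in> X"
      then show "d v \<in> (if v \<in> x ` I then {inv_into I x v} else I)"
        using PiE_mem[OF d(1)] d(2) inv_into_f_f[OF x(2)] by (cases "v \<in> x ` I") auto
    qed (rule PiE_arb[OF d(1)])
  next
    fix d assume d: "d \<in> (\<Pi>\<^sub>E v\<in>X. if v \<in> x ` I then {inv_into I x v} else I)"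
    have "d v \<in> I" if "v \<in> X" for v
      using PiE_mem[OF d that] inv_into_into[of v x I] by (cases "v \<in> x ` I") auto
    then have "d \<in> X \<rightarrow>\<^sub>E I" using PiE_arb[OF d] by (intro PiE_I)
    moreover have "d (x i) = i" if "i \<in> I" for i
      using PiE_mem[OF d, of "x i"] sub that inv_into_f_f[OF x(2) that] by auto
    ultimately show "d \<in> {c \<in> X \<rightarrow>\<^sub>E I. \<forall>i\<in>I. c (x i) = i}" by blast
  qed
  also have "card \<dots> = (\<Prod>v\<in>X. if v \<in> x ` I then 1 else r)"
    unfolding card_PiE[OF assms(1)] by (intro prod.cong) (simp_all add: I_def)
  also have "\<dots> = r ^ card (X - x ` I)"
    using assms(1) by (simp add: prod.If_cases Diff_eq)
  also have "card (X - x ` I) = card X - r"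
    using card_Diff_subset[OF _ sub] c I_def by simp
  finally show ?thesis unfolding I_def .
qed

text \<open>Double counting of pairs of a colouring and a compatible tuple: every tuple is counted
  equally often, so summing over colourings removes the colour condition up to a constant
  factor.\<close>

lemma sum_over_colourings:
  assumes "finite X" "A \<subseteq> distinct_tuples r X"
  shows "(\<Sum>c\<in>X \<rightarrow>\<^sub>E {1..r}. card {x \<in> A. \<forall>i\<in>{1..r}. c (x i) = i \<and> Q i x})
    = r ^ (card X - r) * card {x \<in> A. \<forall>i\<in>{1..r}. Q i x}"
proof -
  define A' where "A' = {x \<in> A. \<forall>i\<in>{1..r}. Q i x}"
  have sub: "A' \<subseteq> distinct_tuples r X" using assms(2) unfolding A'_def by blast
  have "finite A'" using finite_subset[OF sub finite_distinct_tuples[OF assms(1)]] .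
  moreover have "finite (X \<rightarrow>\<^sub>E {1..r})" using assms(1) by (simp add: finite_PiE)
  moreover have "\<forall>x\<in>A'. card {c \<in> X \<rightarrow>\<^sub>E {1..r}. \<forall>i\<in>{1..r}. c (x i) = i} = r ^ (card X - r)"
    using card_compatible_colourings[OF assms(1)] sub by blast
  ultimately have "(\<Sum>c\<in>X \<rightarrow>\<^sub>E {1..r}. card {x \<in> A'. \<forall>i\<in>{1..r}. c (x i) = i})
      = r ^ (card X - r) * card A'"
    using sum_multicount[of "X \<rightarrow>\<^sub>E {1..r}" A' "\<lambda>c x. \<forall>i\<in>{1..r}. c (x i) = i"] by blast
  moreover have "{x \<in> A'. \<forall>i\<in>{1..r}. c (x i) = i} = {x \<in> A. \<forall>i\<in>{1..r}. c (x i) = i \<and> Q i x}" for c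
    unfolding A'_def by blast
  ultimately show ?thesis unfolding A'_def by simp
qed

text \<open>The estimate for correctly coloured tuples is summed over all colourings. A random
  colouring is compatible with a given tuple with probability \<open>1 / r ^ r\<close>, which is the
  origin of the factor \<open>r ^ r\<close>.\<close>

lemma ordered_discrepancy:
  assumes r: "1 \<le> r" and fin: "finite X" and G: "uniform_hypergraph r X G" and reg: "regular_in r X \<epsilon> G"
    and local: "\<And>i x y. i \<in> {1..r} \<Longrightarrow> (\<And>j. j \<in> {1..r} - {i} \<Longrightarrow> x j = y j) \<Longrightarrow> Q i x = Q i y"
  shows "\<bar>real (card {x \<in> G. \<forall>i\<in>{1..r}. Q i x})
      - real (card G) / real (card (distinct_tuples r X))
        * real (card {x \<in> distinct_tuples r X. \<forall>i\<in>{1..r}. Q i x})\<bar>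
    \<le> real r ^ r * \<bar>\<epsilon>\<bar> * real (card (distinct_tuples r X))"
proof -
  define K where "K = distinct_tuples r X"
  define p where "p = real (card G) / real (card K)"
  define N where "N H = real (card {x \<in> H. \<forall>i\<in>{1..r}. Q i x})" for H :: "(nat \<Rightarrow> 'a) set"
  define M where "M c H = real (card {x \<in> H. \<forall>i\<in>{1..r}. c (x i) = i \<and> Q i x})"
    for c :: "'a \<Rightarrow> nat" and H :: "(nat \<Rightarrow> 'a) set"
  have GK: "G \<subseteq> K" using G unfolding uniform_hypergraph_def K_def by blast
  have finK: "finite K" using finite_distinct_tuples[OF fin] by (simp add: K_def)
  have "\<bar>N G - p * N K\<bar> \<le> real r ^ r * \<bar>\<epsilon>\<bar> * real (card K)"
  proof (cases "K = {}")
    case True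
    then show ?thesis using GK by (simp add: N_def)
  next
    case ne: False
    then have cK: "card K > 0" using finK by (simp add: card_gt_0_iff)
    show ?thesis
    proof (cases "r = 1")
      case True
      \<comment> \<open>For \<open>r = 1\<close> the only coordinate is the ignored one, so
        \<open>Q 1\<close> is constant: both counts are complete or both are zero, and the
        discrepancy vanishes.\<close>
      have "Q 1 x = Q 1 y" for x y using local[of 1 x y] True by simp
      then obtain q where "\<And>x. Q 1 x = q" by blast
      then have "{x \<in> H. \<forall>i\<in>{1..r}. Q i x} = (if q then H else {})" for H
        using True by auto
      then have "N G - p * N K = 0"
        using cK by (simp add: N_def p_def)
      then show ?thesis by simp
    next
      case False
      then have r2: "2 \<le> r" using r by simp
      \<comment> \<open>A distinct tuple gives \<open>r \<le> card X\<close>, so that the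
        natural-number difference \<open>card X - r\<close> is a true one when
        \<open>r ^ card X\<close> is factored below.\<close>
      obtain x where x: "x \<in> {1..r} \<rightarrow>\<^sub>E X" "inj_on x {1..r}"
        using ne unfolding K_def distinct_tuples_def by blast
      have "card {1..r} \<le> card X"
        using PiE_mem[OF x(1)] x(2) fin by (intro card_inj_on_le[of x]) auto
      then have rX: "r \<le> card X" by simp
      have S: "(\<Sum>c\<in>X \<rightarrow>\<^sub>E {1..r}. M c H) = real r ^ (card X - r) * N H" if "H \<subseteq> K" for H
        using sum_over_colourings[OF fin that[unfolded K_def], of Q]
        unfolding M_def N_def by (simp flip: of_nat_sum of_nat_mult of_nat_power)
      have "real r ^ (card X - r) * \<bar>N G - p * N K\<bar> = \<bar>real r ^ (card X - r) * N G - p * (real r ^ (card X - r) * N K)\<bar>"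
      proof -
        have "real r ^ (card X - r) * \<bar>N G - p * N K\<bar> = \<bar>real r ^ (card X - r) * (N G - p * N K)\<bar>"
          by (simp add: abs_mult)
        then show ?thesis by (simp add: right_diff_distrib mult.left_commute)
      qed
      also have "\<dots> = \<bar>\<Sum>c\<in>X \<rightarrow>\<^sub>E {1..r}. M c G - p * M c K\<bar>"
        using S[OF GK] S[OF order_refl] by (simp only: sum_subtractf sum_distrib_left[symmetric])
      also have "\<dots> \<le> (\<Sum>c\<in>X \<rightarrow>\<^sub>E {1..r}. \<bar>M c G - p * M c K\<bar>)"
        by (rule sum_abs)
      also have "\<dots> \<le> (\<Sum>c\<in>X \<rightarrow>\<^sub>E {1..r}. \<bar>\<epsilon>\<bar> * real (card K))"
        unfolding M_def p_def K_def
        by (intro sum_mono transversal_discrepancy[where Q = Q, OF r2 fin G reg local])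
      also have "\<dots> = real r ^ card X * (\<bar>\<epsilon>\<bar> * real (card K))"
        by (simp add: card_funcsetE[OF fin])
      also have "\<dots> = real r ^ (card X - r) * (real r ^ r * \<bar>\<epsilon>\<bar> * real (card K))"
      proof -
        have "real r ^ card X = real r ^ (card X - r) * real r ^ r"
          using rX by (simp flip: power_add)
        then show ?thesis by (simp only: mult.assoc)
      qed
      finally show ?thesis using r by simp
    qed
  qed
  then show ?thesis unfolding N_def K_def p_def .
qed

section \<open>Counting maps fibre by fibre and removing one condition\<close>

text \<open>A map on \<open>V\<close> is the same as its restriction to \<open>V - S\<close>
  together with the tuple of its values along the enumeration \<open>s\<close> of \<open>S\<close>;
  \<open>glue\<close> reassembles the two. With the outside values fixed, the estimates for tuples
  become available.\<close>

lemma card_maps_fibrewise: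
  fixes s :: "nat \<Rightarrow> 'b" and X :: "'a set"
  defines "glue \<equiv> \<lambda>S s r (\<psi>::'b \<Rightarrow> 'a) (x::nat \<Rightarrow> 'a) v. if v \<in> S then x (inv_into {1..r::nat} s v) else \<psi> v"
  assumes fin: "finite V" "finite X" and SV: "S \<subseteq> V" and s: "bij_betw s {1..r} S"
  shows "card {\<phi> \<in> V \<rightarrow>\<^sub>E X. \<Phi> \<phi>}
    = (\<Sum>\<psi>\<in>(V - S) \<rightarrow>\<^sub>E X. card {x \<in> {1..r} \<rightarrow>\<^sub>E X. \<Phi> (glue S s r \<psi> x)})"
proof -
  define I where "I = {1..r}"
  define t where "t = inv_into I s"
  define j where "j \<psi> x v = (if v \<in> S then x (t v) else \<psi> v)" for \<psi> :: "'b \<Rightarrow> 'a" and x v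
  have j_eq: "glue S s r = j" unfolding glue_def j_def t_def I_def by (intro ext) simp
  have inv: "s i \<in> S" "t (s i) = i" if "i \<in> I" for i
    using s that unfolding t_def I_def bij_betw_def by (auto intro!: inv_into_f_f)
  have inv': "t v \<in> I" "s (t v) = v" if "v \<in> S" for v
    using s that unfolding t_def I_def bij_betw_def by (auto intro: inv_into_into f_inv_into_f)
  let ?D = "SIGMA \<psi>:(V - S) \<rightarrow>\<^sub>E X. {x \<in> I \<rightarrow>\<^sub>E X. \<Phi> (j \<psi> x)}"
  have "bij_betw (\<lambda>(\<psi>, x). j \<psi> x) ?D {\<phi> \<in> V \<rightarrow>\<^sub>E X. \<Phi> \<phi>}"
  proof (rule bij_betw_byWitness[where f' = "\<lambda>\<phi>. (restrict \<phi> (V - S), \<lambda>i\<in>I. \<phi> (s i))"])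
    show "\<forall>d\<in>?D. (\<lambda>\<phi>. (restrict \<phi> (V - S), \<lambda>i\<in>I. \<phi> (s i))) ((\<lambda>(\<psi>, x). j \<psi> x) d) = d"
    proof
      fix d assume "d \<in> ?D"
      then obtain \<psi> x where d: "d = (\<psi>, x)" "\<psi> \<in> (V - S) \<rightarrow>\<^sub>E X" "x \<in> I \<rightarrow>\<^sub>E X" by blast
      have "restrict (j \<psi> x) (V - S) v = \<psi> v" for v
        using PiE_arb[OF d(2), of v] by (cases "v \<in> V - S") (auto simp: j_def)
      moreover have "(\<lambda>i\<in>I. j \<psi> x (s i)) i = x i" for i
        using PiE_arb[OF d(3), of i] inv[of i] by (cases "i \<in> I") (auto simp: j_def)
      ultimately show "(\<lambda>\<phi>. (restrict \<phi> (V - S), \<lambda>i\<in>I. \<phi> (s i))) ((\<lambda>(\<psi>, x). j \<psi> x) d) = d"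
        unfolding d(1) by (simp add: fun_eq_iff)
    qed
    have restore: "j (restrict \<phi> (V - S)) (\<lambda>i\<in>I. \<phi> (s i)) = \<phi>" if mem: "\<phi> \<in> V \<rightarrow>\<^sub>E X" for \<phi>
    proof
      fix v
      show "j (restrict \<phi> (V - S)) (\<lambda>i\<in>I. \<phi> (s i)) v = \<phi> v"
        using PiE_arb[OF mem, of v] inv'[of v] SV
        by (cases "v \<in> S"; cases "v \<in> V") (auto simp: j_def)
    qed
    then show "\<forall>\<phi>\<in>{\<phi> \<in> V \<rightarrow>\<^sub>E X. \<Phi> \<phi>}.
        (\<lambda>(\<psi>, x). j \<psi> x) ((\<lambda>\<phi>. (restrict \<phi> (V - S), \<lambda>i\<in>I. \<phi> (s i))) \<phi>) = \<phi>"
      by simp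
    show "(\<lambda>(\<psi>, x). j \<psi> x) ` ?D \<subseteq> {\<phi> \<in> V \<rightarrow>\<^sub>E X. \<Phi> \<phi>}"
    proof (rule image_subsetI)
      fix d assume "d \<in> ?D"
      then obtain \<psi> x where d: "d = (\<psi>, x)" "\<psi> \<in> (V - S) \<rightarrow>\<^sub>E X" "x \<in> I \<rightarrow>\<^sub>E X" "\<Phi> (j \<psi> x)" by blast
      have "j \<psi> x \<in> V \<rightarrow>\<^sub>E X"
      proof (rule PiE_I)
        fix v assume "v \<in> V"
        then show "j \<psi> x v \<in> X"
          using PiE_mem[OF d(2), of v] PiE_mem[OF d(3) inv'(1), of v] by (simp add: j_def)
      next
        fix v assume "v \<notin> V"
        then show "j \<psi> x v = undefined"
          using PiE_arb[OF d(2), of v] SV by (auto simp: j_def)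
      qed
      then show "(\<lambda>(\<psi>, x). j \<psi> x) d \<in> {\<phi> \<in> V \<rightarrow>\<^sub>E X. \<Phi> \<phi>}" using d by simp
    qed
    show "(\<lambda>\<phi>. (restrict \<phi> (V - S), \<lambda>i\<in>I. \<phi> (s i))) ` {\<phi> \<in> V \<rightarrow>\<^sub>E X. \<Phi> \<phi>} \<subseteq> ?D"
    proof (rule image_subsetI)
      fix \<phi> assume "\<phi> \<in> {\<phi> \<in> V \<rightarrow>\<^sub>E X. \<Phi> \<phi>}"
      then have \<phi>: "\<phi> \<in> V \<rightarrow>\<^sub>E X" "\<Phi> \<phi>" by blast+
      have "restrict \<phi> (V - S) \<in> (V - S) \<rightarrow>\<^sub>E X" "(\<lambda>i\<in>I. \<phi> (s i)) \<in> I \<rightarrow>\<^sub>E X"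
        using PiE_mem[OF \<phi>(1)] inv(1) SV by (simp_all add: subset_iff)
      then show "(restrict \<phi> (V - S), \<lambda>i\<in>I. \<phi> (s i)) \<in> ?D"
        using restore[OF \<phi>(1)] \<phi>(2) by simp
    qed
  qed
  then have "card {\<phi> \<in> V \<rightarrow>\<^sub>E X. \<Phi> \<phi>} = card ?D" by (rule bij_betw_same_card[symmetric])
  also have "\<dots> = (\<Sum>\<psi>\<in>(V - S) \<rightarrow>\<^sub>E X. card {x \<in> I \<rightarrow>\<^sub>E X. \<Phi> (j \<psi> x)})"
    using fin by (intro card_SigmaI) (simp_all add: finite_PiE I_def)
  finally show ?thesis unfolding j_eq I_def .
qed

lemma image_in_edges_iff_mem:
  assumes "uniform_hypergraph r X G" "x \<in> {1..r} \<rightarrow>\<^sub>E X"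
  shows "x ` {1..r} \<in> edges r G \<longleftrightarrow> x \<in> G"
proof (cases "inj_on x {1..r}")
  case True
  then show ?thesis
    using assms image_in_edges_iff[OF assms(1)] by (simp add: distinct_tuples_def)
next
  case False
  have GK: "G \<subseteq> distinct_tuples r X" using assms(1) unfolding uniform_hypergraph_def by blast
  have "x ` {1..r} \<notin> edges r G"
  proof
    assume "x ` {1..r} \<in> edges r G"
    then obtain y where "y \<in> G" "x ` {1..r} = y ` {1..r}" unfolding edges_def by blast
    moreover from this GK have "inj_on y {1..r}" unfolding distinct_tuples_def by blast
    ultimately have "card (x ` {1..r}) = card {1..r}" by (simp add: card_image)
    then have "inj_on x {1..r}" by (intro eq_card_imp_inj_on) simp_all
    then show False using False by blast
  qed
  moreover have "x \<notin> G" using False GK unfolding distinct_tuples_def by blast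
  ultimately show ?thesis by blast
qed

text \<open>With the values off \<open>S\<close> fixed, a condition on \<open>T\<close> ignores the
  coordinate of any point of \<open>S - T\<close>, and such a point exists. The conditions thus have
  the form required by \<open>ordered_discrepancy\<close>, and its error is summed over the maps on
  \<open>V - S\<close>. The comparison term keeps \<open>inj_on \<phi> S\<close> because regularity
  compares \<open>G\<close> with distinct tuples only.\<close>

lemma counting_step:
  fixes R :: "'b set \<Rightarrow> 'a set \<Rightarrow> bool"
  assumes fin: "finite V" "finite X" and SV: "S \<subseteq> V" and S: "card S = r" "1 \<le> r"
    and G: "uniform_hypergraph r X G" "regular_in r X \<epsilon> G"
    and TS: "\<And>T. T \<in> \<T> \<Longrightarrow> \<not> S \<subseteq> T"
  shows "\<bar>real (card {\<phi> \<in> V \<rightarrow>\<^sub>E X. \<phi> ` S \<in> edges r G \<and> (\<forall>T\<in>\<T>. R T (\<phi> ` T))})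
      - real (card G) / real (card (distinct_tuples r X))
        * real (card {\<phi> \<in> V \<rightarrow>\<^sub>E X. inj_on \<phi> S \<and> (\<forall>T\<in>\<T>. R T (\<phi> ` T))})\<bar>
    \<le> real r ^ r * \<bar>\<epsilon>\<bar> * real (card (distinct_tuples r X)) * real (card X) ^ (card V - r)"
proof -
  define I where "I = {1..r}"
  define K where "K = distinct_tuples r X"
  define p where "p = real (card G) / real (card K)"
  have finS: "finite S" using SV fin(1) by (rule finite_subset)
  obtain s where s: "bij_betw s {1..r} S"
    using ex_bij_betw_nat_finite_1[OF finS] S(1) by blast
  define t where "t = inv_into {1..r} s"
  define glue where "glue \<psi> x v = (if v \<in> S then x (t v) else \<psi> v)" for \<psi> :: "'b \<Rightarrow> 'a" and x v
  have t: "bij_betw t S I" using bij_betw_inv_into[OF s] by (simp add: t_def I_def)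
  have st: "s (t v) = v" if "v \<in> S" for v
    using s that unfolding t_def bij_betw_def by (simp add: f_inv_into_f)
  \<comment> \<open>\<open>Q \<psi> i\<close> collects the conditions on sets avoiding the
    \<open>i\<close>-th point of \<open>S\<close>. A set may be collected for several
    \<open>i\<close>, but only the conjunction over all \<open>i\<close> matters, and no set is
    missed.\<close>
  define Q where "Q \<psi> i x \<longleftrightarrow> (\<forall>T\<in>\<T>. s i \<notin> T \<longrightarrow> R T (glue \<psi> x ` T))" for \<psi> i x
  have glue_S: "glue \<psi> x ` S = x ` I" for \<psi> x
  proof -
    have "glue \<psi> x ` S = x ` (t ` S)" by (simp add: glue_def image_image)
    then show ?thesis using t by (simp add: bij_betw_def)
  qed
  have Q: "(\<forall>T\<in>\<T>. R T (glue \<psi> x ` T)) \<longleftrightarrow> (\<forall>i\<in>I. Q \<psi> i x)" for \<psi> x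
  proof
    assume r: "\<forall>i\<in>I. Q \<psi> i x"
    show "\<forall>T\<in>\<T>. R T (glue \<psi> x ` T)"
    proof
      fix T assume T: "T \<in> \<T>"
      then obtain v where v: "v \<in> S" "v \<notin> T" using TS by blast
      then have "t v \<in> I" "s (t v) \<notin> T" using t st by (auto simp: bij_betw_def)
      then show "R T (glue \<psi> x ` T)" using r T unfolding Q_def by blast
    qed
  qed (simp add: Q_def)
  have local: "Q \<psi> i x = Q \<psi> i y" if "i \<in> {1..r}" and xy: "\<And>j. j \<in> {1..r} - {i} \<Longrightarrow> x j = y j" for \<psi> i x y
  proof -
    have "glue \<psi> x ` T = glue \<psi> y ` T" if T: "s i \<notin> T" for T
    proof (rule image_cong)
      fix v assume v: "v \<in> T"
      show "glue \<psi> x v = glue \<psi> y v"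
      proof (cases "v \<in> S")
        case True
        then have "t v \<in> {1..r} - {i}" using st[OF True] v T bij_betwE[OF t] unfolding I_def by force
        then show ?thesis using True xy[of "t v"] by (simp add: glue_def)
      qed (simp add: glue_def)
    qed simp
    then show ?thesis unfolding Q_def by metis
  qed
  have edge_fibre: "{x \<in> {1..r} \<rightarrow>\<^sub>E X. glue \<psi> x ` S \<in> edges r G \<and> (\<forall>T\<in>\<T>. R T (glue \<psi> x ` T))}
      = {x \<in> G. \<forall>i\<in>{1..r}. Q \<psi> i x}" for \<psi>
  proof -
    have "G \<subseteq> {1..r} \<rightarrow>\<^sub>E X" using G(1) unfolding uniform_hypergraph_def distinct_tuples_def by blast
    then show ?thesis
      unfolding glue_S Q I_def using image_in_edges_iff_mem[OF G(1)] by blast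
  qed
  have inj_fibre: "{x \<in> {1..r} \<rightarrow>\<^sub>E X. inj_on (glue \<psi> x) S \<and> (\<forall>T\<in>\<T>. R T (glue \<psi> x ` T))}
      = {x \<in> K. \<forall>i\<in>{1..r}. Q \<psi> i x}" for \<psi>
  proof -
    have "inj_on (glue \<psi> x) S \<longleftrightarrow> inj_on x {1..r}" for x
    proof -
      have "inj_on (glue \<psi> x) S \<longleftrightarrow> inj_on (x \<circ> t) S"
        by (intro inj_on_cong) (simp add: glue_def)
      also have "\<dots> \<longleftrightarrow> inj_on x (t ` S)"
        using comp_inj_on_iff[of t S x] t by (simp add: bij_betw_def)
      finally show ?thesis using t by (simp add: bij_betw_def I_def)
    qed
    then show ?thesis unfolding Q I_def K_def distinct_tuples_def by blast
  qed
  let ?\<Psi> = "(V - S) \<rightarrow>\<^sub>E X"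
  have "card {\<phi> \<in> V \<rightarrow>\<^sub>E X. \<phi> ` S \<in> edges r G \<and> (\<forall>T\<in>\<T>. R T (\<phi> ` T))}
      = (\<Sum>\<psi>\<in>?\<Psi>. card {x \<in> {1..r} \<rightarrow>\<^sub>E X. glue \<psi> x ` S \<in> edges r G \<and> (\<forall>T\<in>\<T>. R T (glue \<psi> x ` T))})"
    unfolding glue_def t_def
    by (rule card_maps_fibrewise[OF fin SV s, of "\<lambda>\<phi>. \<phi> ` S \<in> edges r G \<and> (\<forall>T\<in>\<T>. R T (\<phi> ` T))"])
  then have N1: "card {\<phi> \<in> V \<rightarrow>\<^sub>E X. \<phi> ` S \<in> edges r G \<and> (\<forall>T\<in>\<T>. R T (\<phi> ` T))}
      = (\<Sum>\<psi>\<in>?\<Psi>. card {x \<in> G. \<forall>i\<in>{1..r}. Q \<psi> i x})"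
    unfolding edge_fibre .
  have "card {\<phi> \<in> V \<rightarrow>\<^sub>E X. inj_on \<phi> S \<and> (\<forall>T\<in>\<T>. R T (\<phi> ` T))}
      = (\<Sum>\<psi>\<in>?\<Psi>. card {x \<in> {1..r} \<rightarrow>\<^sub>E X. inj_on (glue \<psi> x) S \<and> (\<forall>T\<in>\<T>. R T (glue \<psi> x ` T))})"
    unfolding glue_def t_def
    by (rule card_maps_fibrewise[OF fin SV s, of "\<lambda>\<phi>. inj_on \<phi> S \<and> (\<forall>T\<in>\<T>. R T (\<phi> ` T))"])
  then have N2: "card {\<phi> \<in> V \<rightarrow>\<^sub>E X. inj_on \<phi> S \<and> (\<forall>T\<in>\<T>. R T (\<phi> ` T))}
      = (\<Sum>\<psi>\<in>?\<Psi>. card {x \<in> K. \<forall>i\<in>{1..r}. Q \<psi> i x})"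
    unfolding inj_fibre .
  have "\<bar>real (\<Sum>\<psi>\<in>?\<Psi>. card {x \<in> G. \<forall>i\<in>{1..r}. Q \<psi> i x})
        - p * real (\<Sum>\<psi>\<in>?\<Psi>. card {x \<in> K. \<forall>i\<in>{1..r}. Q \<psi> i x})\<bar>
      = \<bar>\<Sum>\<psi>\<in>?\<Psi>. real (card {x \<in> G. \<forall>i\<in>{1..r}. Q \<psi> i x})
        - p * real (card {x \<in> K. \<forall>i\<in>{1..r}. Q \<psi> i x})\<bar>"
    by (simp only: of_nat_sum sum_subtractf sum_distrib_left)
  also have "\<dots> \<le> (\<Sum>\<psi>\<in>?\<Psi>. \<bar>real (card {x \<in> G. \<forall>i\<in>{1..r}. Q \<psi> i x})
        - p * real (card {x \<in> K. \<forall>i\<in>{1..r}. Q \<psi> i x})\<bar>)"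
    by (rule sum_abs)
  also have "\<dots> \<le> (\<Sum>\<psi>\<in>?\<Psi>. real r ^ r * \<bar>\<epsilon>\<bar> * real (card K))"
    unfolding p_def K_def
  proof (rule sum_mono)
    fix \<psi>
    show "\<bar>real (card {x \<in> G. \<forall>i\<in>{1..r}. Q \<psi> i x})
        - real (card G) / real (card (distinct_tuples r X))
          * real (card {x \<in> distinct_tuples r X. \<forall>i\<in>{1..r}. Q \<psi> i x})\<bar>
      \<le> real r ^ r * \<bar>\<epsilon>\<bar> * real (card (distinct_tuples r X))"
      by (rule ordered_discrepancy[where Q = "Q \<psi>", OF S(2) fin(2) G local])
  qed
  also have "\<dots> = real r ^ r * \<bar>\<epsilon>\<bar> * real (card K) * real (card X) ^ (card V - r)"
    using fin(1) finS SV S(1) by (simp add: card_funcsetE card_Diff_subset)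
  finally show ?thesis unfolding N1 N2 p_def K_def .
qed

section \<open>Asymptotic densities\<close>

lemma distinct_tuples_nonempty:
  assumes "r \<le> card X" "finite X"
  shows "distinct_tuples r X \<noteq> {}"
proof -
  obtain T where "T \<subseteq> X" "card T = r" "finite T"
    using obtain_subset_with_card_n[OF assms(1)] assms(2) finite_subset by metis
  then have "T \<in> edges r {y \<in> distinct_tuples r X. True}"
    using edges_of_set_property[of r X "\<lambda>_. True"] by blast
  then show ?thesis unfolding edges_def by blast
qed

text \<open>The \<open>l\<close> densities sum to \<open>1\<close> and differ pairwise by at most
  \<open>\<bar>\<delta>\<bar>\<close>, so each is that close to their average \<open>1 / l\<close>.
  Nonemptiness keeps the denominator positive.\<close>

lemma equitable_part_density:
  assumes fin: "finite X" and hp: "hyperpartition k l X P" and eq: "equitable k l X \<delta> P"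
    and r: "r \<in> {1..k}" and j: "j \<in> {1..l}" and ne: "distinct_tuples r X \<noteq> {}"
  shows "\<bar>real (card (P r j)) / real (card (distinct_tuples r X)) - 1 / real l\<bar> \<le> \<bar>\<delta>\<bar>"
proof -
  define K where "K = distinct_tuples r X"
  define p where "p m = real (card (P r m)) / real (card K)" for m
  have finK: "finite K" using finite_distinct_tuples[OF fin] by (simp add: K_def)
  have cK: "real (card K) > 0" using finK ne by (simp add: card_gt_0_iff K_def)
  have l: "real l > 0" using j by simp
  have disj: "disjoint_family_on (P r) {1..l}" and un: "(\<Union>m\<in>{1..l}. P r m) = K"
    using hp r unfolding hyperpartition_def K_def by blast+
  have fP: "finite (P r m)" if "m \<in> {1..l}" for m
    using finite_subset[OF _ finK] un that by blast
  have "card K = (\<Sum>m\<in>{1..l}. card (P r m))"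
    using disj fP unfolding un[symmetric] disjoint_family_on_def
    by (intro card_UN_disjoint) blast+
  then have "(\<Sum>m\<in>{1..l}. p m) = 1"
    using cK unfolding p_def sum_divide_distrib[symmetric] of_nat_sum[symmetric] by simp
  then have "real l * (p j - 1 / real l) = (\<Sum>m\<in>{1..l}. p j - p m)"
    using l by (simp add: sum_subtractf right_diff_distrib)
  then have "real l * \<bar>p j - 1 / real l\<bar> = \<bar>\<Sum>m\<in>{1..l}. p j - p m\<bar>"
    using l by (metis abs_mult abs_of_pos)
  also have "\<dots> \<le> (\<Sum>m\<in>{1..l}. \<bar>p j - p m\<bar>)" by (rule sum_abs)
  also have "\<dots> \<le> (\<Sum>m\<in>{1..l}. \<bar>\<delta>\<bar>)"
  proof (rule sum_mono)
    fix m assume m: "m \<in> {1..l}"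
    have le: "\<bar>p a - p b\<bar> \<le> \<bar>\<delta>\<bar>" if "a \<in> {1..l}" "b \<in> {1..l}" "a < b" for a b
    proof -
      have "\<bar>real (card (P r a)) - real (card (P r b))\<bar> / real (card K) < \<delta>"
        using eq r that unfolding equitable_def K_def by blast
      moreover have "\<bar>p a - p b\<bar> = \<bar>real (card (P r a)) - real (card (P r b))\<bar> / real (card K)"
        unfolding p_def using cK by (simp flip: diff_divide_distrib)
      ultimately show ?thesis by linarith
    qed
    consider "m < j" | "m = j" | "j < m" by linarith
    then show "\<bar>p j - p m\<bar> \<le> \<bar>\<delta>\<bar>"
      using le[OF j m] le[OF m j] by cases (simp_all add: abs_minus_commute)
  qed
  also have "\<dots> = real l * \<bar>\<delta>\<bar>" by simp
  finally show ?thesis using l unfolding p_def K_def by simp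
qed

text \<open>The proportion of injective maps is the product of the ratios \<open>(n - j) / n\<close>
  over \<open>j < card V\<close>, a fixed number of factors each tending to
  \<open>1\<close>.\<close>

lemma noninjective_negligible:
  fixes U :: "nat \<Rightarrow> 'a set" and V :: "'b set"
  assumes "\<And>i. finite (U i)" "finite V" and lim: "filterlim (\<lambda>i. card (U i)) at_top sequentially"
  shows "(\<lambda>i. real (card {\<phi> \<in> V \<rightarrow>\<^sub>E U i. \<not> inj_on \<phi> V}) / real (card (U i)) ^ card V) \<longlonglongrightarrow> 0"
proof -
  define n where "n i = card (U i)" for i
  define v where "v = card V"
  have rlim: "filterlim (\<lambda>i. real (n i)) at_top sequentially"
    using filterlim_compose[OF filterlim_real_sequentially lim] unfolding n_def .
  have "(\<lambda>i. real (n i - j) / real (n i)) \<longlonglongrightarrow> 1" for j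
  proof -
    have "(\<lambda>i. 1 - real j / real (n i)) \<longlonglongrightarrow> 1 - 0"
      by (intro tendsto_diff tendsto_const tendsto_divide_0[OF tendsto_const]
          filterlim_at_top_imp_at_infinity rlim)
    \<comment> \<open>Once \<open>n i\<close> exceeds \<open>j\<close>, the natural-number
      subtraction is a true one and the denominator is nonzero.\<close>
    moreover have "\<forall>\<^sub>F i in sequentially. 1 - real j / real (n i) = real (n i - j) / real (n i)"
      using filterlim_at_top[THEN iffD1, OF lim, rule_format, of "Suc j"]
      by eventually_elim (simp add: n_def of_nat_diff diff_divide_distrib)
    ultimately have "(\<lambda>i. real (n i - j) / real (n i)) \<longlonglongrightarrow> 1 - 0"
      by (rule Lim_transform_eventually)
    then show ?thesis by (simp only: diff_zero)
  qed
  then have "(\<lambda>i. \<Prod>j\<in>{0..<v}. real (n i - j) / real (n i)) \<longlonglongrightarrow> (\<Prod>j\<in>{0..<v}. 1)"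
    by (intro tendsto_prod)
  then have "(\<lambda>i. 1 - (\<Prod>j\<in>{0..<v}. real (n i - j) / real (n i))) \<longlonglongrightarrow> 1 - 1"
    by (intro tendsto_diff tendsto_const) simp
  moreover have "\<forall>\<^sub>F i in sequentially. 1 - (\<Prod>j\<in>{0..<v}. real (n i - j) / real (n i))
      = real (card {\<phi> \<in> V \<rightarrow>\<^sub>E U i. \<not> inj_on \<phi> V}) / real (n i) ^ v"
    using filterlim_at_top[THEN iffD1, OF lim, rule_format, of 1]
  proof eventually_elim
    case (elim i)
    let ?I = "{\<phi> \<in> V \<rightarrow>\<^sub>E U i. inj_on \<phi> V}"
    have fin: "finite (V \<rightarrow>\<^sub>E U i)" using assms by (simp add: finite_PiE)
    have "{\<phi> \<in> V \<rightarrow>\<^sub>E U i. \<not> inj_on \<phi> V} = (V \<rightarrow>\<^sub>E U i) - ?I" by blast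
    moreover have "card ?I \<le> card (V \<rightarrow>\<^sub>E U i)" using fin by (intro card_mono) auto
    ultimately have "real (card {\<phi> \<in> V \<rightarrow>\<^sub>E U i. \<not> inj_on \<phi> V}) = real (card (V \<rightarrow>\<^sub>E U i)) - real (card ?I)"
      using fin by (simp add: card_Diff_subset of_nat_diff)
    also have "card ?I = (\<Prod>j\<in>{0..<v}. n i - j)"
      using card_inj_on_subset_funcset[OF assms(2) assms(1) order_refl] by (simp add: v_def n_def)
    also have "card (V \<rightarrow>\<^sub>E U i) = n i ^ v"
      using assms(2) by (simp add: card_funcsetE v_def n_def)
    finally show ?case
      using elim by (simp add: n_def prod_dividef diff_divide_distrib)
  qed
  ultimately have "(\<lambda>i. real (card {\<phi> \<in> V \<rightarrow>\<^sub>E U i. \<not> inj_on \<phi> V}) / real (n i) ^ v) \<longlonglongrightarrow> 1 - 1"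
    by (rule Lim_transform_eventually)
  then show ?thesis unfolding n_def v_def by (simp only: diff_self)
qed

text \<open>Induction on the family of conditions, adding them in order of increasing size. By
  \<open>counting_step\<close> each new condition multiplies the limiting density by
  \<open>1 / l\<close>, the errors being the regularity error and the share of non-injective
  maps.\<close>

lemma cell_density_tendsto:
  fixes U :: "nat \<Rightarrow> 'a set" and V :: "'b set"
  assumes finU: "\<And>i. finite (U i)" and lim: "filterlim (\<lambda>i. card (U i)) at_top sequentially"
    and hp: "\<And>i. hyperpartition k l (U i) (P i)"
    and reg: "\<And>i. regular_hyperpartition k l (U i) (\<epsilon> i) (P i)"
    and eq: "\<And>i. equitable k l (U i) (\<delta> i) (P i)"
    and \<epsilon>: "\<epsilon> \<longlonglongrightarrow> 0" and \<delta>: "\<delta> \<longlonglongrightarrow> 0"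
    and finV: "finite V" and g: "\<And>T. T \<in> small_subsets V k \<Longrightarrow> g T \<in> {1..l}"
    and A: "finite A" "A \<subseteq> small_subsets V k"
  shows "(\<lambda>i. real (card {\<phi> \<in> V \<rightarrow>\<^sub>E U i. \<forall>T\<in>A. \<phi> ` T \<in> edges (card T) (P i (card T) (g T))})
      / real (card (U i)) ^ card V) \<longlonglongrightarrow> (1 / real l) ^ card A"
  using A
proof (induction rule: finite_ranking_induct[where f = card])
  case empty
  have "\<forall>\<^sub>F i in sequentially. 1 = real (card (V \<rightarrow>\<^sub>E U i)) / real (card (U i)) ^ card V"
    using filterlim_at_top[THEN iffD1, OF lim, rule_format, of 1]
    by eventually_elim (simp add: card_funcsetE[OF finV])
  then have "(\<lambda>i. real (card (V \<rightarrow>\<^sub>E U i)) / real (card (U i)) ^ card V) \<longlonglongrightarrow> 1"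
    by (rule Lim_transform_eventually[OF tendsto_const])
  then show ?case by simp
next
  case (insert S A)
  show ?case
  \<comment> \<open>The ranking induction does not guarantee that the inserted set is new.\<close>
  proof (cases "S \<in> A")
    case True
    then show ?thesis using insert by (simp add: insert_absorb)
  next
    case False
    define r where "r = card S"
    define v where "v = card V"
    define n where "n i = real (card (U i))" for i
    define M where "M B i = {\<phi> \<in> V \<rightarrow>\<^sub>E U i. \<forall>T\<in>B. \<phi> ` T \<in> edges (card T) (P i (card T) (g T))}" for B i
    define N where "N i = {\<phi> \<in> V \<rightarrow>\<^sub>E U i. \<not> inj_on \<phi> V}" for i
    define p where "p i = real (card (P i r (g S))) / real (card (distinct_tuples r (U i)))" for i
    have S: "S \<subseteq> V" "S \<noteq> {}" "card S \<le> k" "S \<in> small_subsets V k" and AV: "A \<subseteq> small_subsets V k"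
      using insert.prems unfolding small_subsets_def by auto
    have finS: "finite S" using S(1) finV by (rule finite_subset)
    have r: "r \<in> {1..k}" using S finS by (simp add: r_def card_gt_0_iff Suc_le_eq)
    have rv: "r \<le> v" using S(1) finV by (simp add: r_def v_def card_mono)
    have gS: "g S \<in> {1..l}" using g S(4) .
    \<comment> \<open>Every member of \<open>A\<close> has at most \<open>card S\<close> points, so
      one containing \<open>S\<close> would equal \<open>S\<close>. This is the hypothesis on
      \<open>\<T>\<close> in \<open>counting_step\<close>.\<close>
    have max: "\<not> S \<subseteq> T" if "T \<in> A" for T
    proof
      assume "S \<subseteq> T"
      moreover have "finite T"
        using that AV finV unfolding small_subsets_def by (blast intro: finite_subset)
      ultimately have "S = T" using insert.hyps(2)[OF that] card_seteq by metis
      then show False using False that by blast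
    qed
    have large: "\<forall>\<^sub>F i in sequentially. max 1 r \<le> card (U i)"
      using filterlim_at_top[THEN iffD1, OF lim] by blast
    have "(\<lambda>i. \<bar>\<delta> i\<bar>) \<longlonglongrightarrow> 0" using \<delta> by (rule tendsto_rabs_zero)
    moreover have "\<forall>\<^sub>F i in sequentially. norm (p i - 1 / real l) \<le> \<bar>\<delta> i\<bar>"
      using large
    proof eventually_elim
      case (elim i)
      then show ?case
        using equitable_part_density[OF finU hp eq r gS distinct_tuples_nonempty[OF _ finU], of i]
        unfolding p_def by simp
    qed
    ultimately have "(\<lambda>i. p i - 1 / real l) \<longlonglongrightarrow> 0"
      by (rule Lim_null_comparison[rotated])
    then have p: "p \<longlonglongrightarrow> 1 / real l" by (simp add: LIM_zero_iff)
    have IH: "(\<lambda>i. real (card (M A i)) / n i ^ v) \<longlonglongrightarrow> (1 / real l) ^ card A"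
      using insert.IH[OF AV] unfolding M_def n_def v_def .
    have noninj: "(\<lambda>i. real (card (N i)) / n i ^ v) \<longlonglongrightarrow> 0"
      unfolding N_def n_def v_def by (rule noninjective_negligible[OF finU finV lim])
    \<comment> \<open>\<open>counting_step\<close> compares with the maps in \<open>M A i\<close>
      that are injective on \<open>S\<close>. Dropping that injectivity costs at most
      \<open>card (N i)\<close>, since \<open>p i \<le> 1\<close>.\<close>
    have step: "\<bar>real (card (M (insert S A) i)) - p i * real (card (M A i))\<bar>
        \<le> real r ^ r * \<bar>\<epsilon> i\<bar> * n i ^ v + real (card (N i))" for i
    proof -
      define M' where "M' = {\<phi> \<in> V \<rightarrow>\<^sub>E U i. inj_on \<phi> S \<and> (\<forall>T\<in>A. \<phi> ` T \<in> edges (card T) (P i (card T) (g T)))}"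
      have finPi: "finite (V \<rightarrow>\<^sub>E U i)" using finV finU by (simp add: finite_PiE)
      have uni: "uniform_hypergraph r (U i) (P i r (g S))"
        using hp r gS unfolding hyperpartition_def by blast
      have rg: "regular_in r (U i) (\<epsilon> i) (P i r (g S))"
        using reg r gS unfolding regular_hyperpartition_def by blast
      have finK: "finite (distinct_tuples r (U i))" using finite_distinct_tuples[OF finU] .
      have "M (insert S A) i = {\<phi> \<in> V \<rightarrow>\<^sub>E U i. \<phi> ` S \<in> edges r (P i r (g S)) \<and>
          (\<forall>T\<in>A. \<phi> ` T \<in> edges (card T) (P i (card T) (g T)))}"
        unfolding M_def r_def by blast
      then have "\<bar>real (card (M (insert S A) i)) - p i * real (card M')\<bar>
          \<le> real r ^ r * \<bar>\<epsilon> i\<bar> * real (card (distinct_tuples r (U i))) * n i ^ (v - r)"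
        using counting_step[where R = "\<lambda>T E. E \<in> edges (card T) (P i (card T) (g T))" and \<T> = A,
            OF finV finU S(1) r_def[symmetric] _ uni rg max] r
        unfolding M'_def p_def n_def v_def by simp
      \<comment> \<open>Bounding the number of distinct tuples by \<open>n i ^ r\<close> gives the
        error the order \<open>n i ^ v\<close> of the total number of maps, so it vanishes with
        \<open>\<epsilon> i\<close> after normalization.\<close>
      also have "\<dots> \<le> real r ^ r * \<bar>\<epsilon> i\<bar> * n i ^ r * n i ^ (v - r)"
      proof -
        have "card (distinct_tuples r (U i)) \<le> card ({1..r} \<rightarrow>\<^sub>E U i)"
          using finU unfolding distinct_tuples_def by (intro card_mono) (auto simp: finite_PiE)
        then have "real (card (distinct_tuples r (U i))) \<le> n i ^ r"
          unfolding n_def by (simp add: card_funcsetE flip: of_nat_power)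
        then show ?thesis by (intro mult_right_mono mult_left_mono) (simp_all add: n_def)
      qed
      also have "\<dots> = real r ^ r * \<bar>\<epsilon> i\<bar> * n i ^ v"
        using rv by (simp add: mult.assoc flip: power_add)
      finally have 1: "\<bar>real (card (M (insert S A) i)) - p i * real (card M')\<bar>
          \<le> real r ^ r * \<bar>\<epsilon> i\<bar> * n i ^ v" .
      have "M A i \<subseteq> M' \<union> N i"
        unfolding M_def M'_def N_def using inj_on_subset[OF _ S(1)] by blast
      then have "card (M A i) \<le> card (M' \<union> N i)"
        using finPi unfolding M'_def N_def by (intro card_mono) auto
      also have "\<dots> \<le> card M' + card (N i)" by (rule card_Un_le)
      finally have 2: "real (card (M A i)) - real (card M') \<le> real (card (N i))" by linarith
      have 3: "real (card M') \<le> real (card (M A i))"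
        unfolding M'_def M_def using finPi by (intro of_nat_mono card_mono) auto
      have "P i r (g S) \<subseteq> distinct_tuples r (U i)" using uni unfolding uniform_hypergraph_def by blast
      then have p01: "0 \<le> p i" "p i \<le> 1"
        unfolding p_def using card_mono[OF finK] by (auto simp: divide_le_eq_1)
      have "p i * (real (card (M A i)) - real (card M')) \<le> 1 * real (card (N i))"
        using p01 2 3 by (intro mult_mono) auto
      moreover have "0 \<le> p i * (real (card (M A i)) - real (card M'))"
        using p01 3 by simp
      ultimately show ?thesis using 1 by (simp add: right_diff_distrib)
    qed
    have "(\<lambda>i. real r ^ r * \<bar>\<epsilon> i\<bar> + real (card (N i)) / n i ^ v) \<longlonglongrightarrow> 0"
      using tendsto_add[OF tendsto_mult_right_zero[OF tendsto_rabs_zero[OF \<epsilon>], of "real r ^ r"] noninj]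
      by simp
    moreover have "\<forall>\<^sub>F i in sequentially.
        norm (real (card (M (insert S A) i)) / n i ^ v - p i * (real (card (M A i)) / n i ^ v))
        \<le> real r ^ r * \<bar>\<epsilon> i\<bar> + real (card (N i)) / n i ^ v"
      using large
    proof eventually_elim
      case (elim i)
      then have "n i > 0" unfolding n_def by simp
      then have pos: "n i ^ v > 0" "n i \<noteq> 0" by simp_all
      have "real (card (M (insert S A) i)) / n i ^ v - p i * (real (card (M A i)) / n i ^ v)
          = (real (card (M (insert S A) i)) - p i * real (card (M A i))) / n i ^ v"
        by (simp add: diff_divide_distrib)
      then have "norm (real (card (M (insert S A) i)) / n i ^ v - p i * (real (card (M A i)) / n i ^ v))
          = \<bar>real (card (M (insert S A) i)) - p i * real (card (M A i))\<bar> / n i ^ v"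
        using pos by simp
      also have "\<dots> \<le> (real r ^ r * \<bar>\<epsilon> i\<bar> * n i ^ v + real (card (N i))) / n i ^ v"
        using step[of i] pos by (intro divide_right_mono) auto
      also have "\<dots> = real r ^ r * \<bar>\<epsilon> i\<bar> + real (card (N i)) / n i ^ v"
        using pos by (simp add: add_divide_distrib)
      finally show ?case .
    qed
    ultimately have "(\<lambda>i. real (card (M (insert S A) i)) / n i ^ v
        - p i * (real (card (M A i)) / n i ^ v)) \<longlonglongrightarrow> 0"
      by (rule Lim_null_comparison[rotated])
    from tendsto_add[OF this tendsto_mult[OF p IH]]
    have "(\<lambda>i. real (card (M (insert S A) i)) / n i ^ v) \<longlonglongrightarrow> 1 / real l * (1 / real l) ^ card A"
      by simp
    moreover have "card (insert S A) = Suc (card A)" using False insert.hyps(1) by simp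
    ultimately show ?thesis unfolding M_def n_def v_def by simp
  qed
qed

section \<open>Homomorphisms as colourings of small subsets\<close>

text \<open>By symmetry of \<open>F\<close>, the bijections from \<open>{1..k}\<close> onto its
  edges are, up to their values outside \<open>{1..k}\<close>, exactly the tuples in
  \<open>F\<close>.\<close>

lemma structure_hom_iff_tuples:
  assumes F: "uniform_hypergraph k V F"
  shows "structure_hom k F C g \<longleftrightarrow> (\<forall>x\<in>F. (\<lambda>S\<in>index_sets k. g (x ` S)) \<in> C)"
proof
  assume h: "structure_hom k F C g"
  show "\<forall>x\<in>F. (\<lambda>S\<in>index_sets k. g (x ` S)) \<in> C"
  proof
    fix x assume x: "x \<in> F"
    then have "x ` {1..k} \<in> edges k F" "inj_on x {1..k}"
      using F unfolding edges_def uniform_hypergraph_def distinct_tuples_def by blast+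
    then show "(\<lambda>S\<in>index_sets k. g (x ` S)) \<in> C"
      using h unfolding structure_hom_def bij_betw_def by blast
  qed
next
  assume h: "\<forall>x\<in>F. (\<lambda>S\<in>index_sets k. g (x ` S)) \<in> C"
  show "structure_hom k F C g"
    unfolding structure_hom_def
  proof (intro ballI allI impI)
    fix E s assume E: "E \<in> edges k F" and s: "bij_betw s {1..k} E"
    define x where "x = restrict s {1..k}"
    have xE: "x ` {1..k} = E"
      using bij_betw_imp_surj_on[OF s] by (simp only: x_def image_restrict_eq)
    have FV: "F \<subseteq> distinct_tuples k V" using F unfolding uniform_hypergraph_def by blast
    have "E \<subseteq> V"
    proof -
      obtain y where "y \<in> F" "E = y ` {1..k}" using E unfolding edges_def by blast
      moreover from this FV have "y \<in> {1..k} \<rightarrow>\<^sub>E V" unfolding distinct_tuples_def by blast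
      ultimately show ?thesis using PiE_mem by (metis image_subsetI)
    qed
    then have "x \<in> {1..k} \<rightarrow>\<^sub>E V"
      using bij_betwE[OF s] unfolding x_def by (intro restrict_PiE_iff[THEN iffD2]) blast
    then have "x \<in> F" using image_in_edges_iff_mem[OF F] E xE by blast
    then have "(\<lambda>S\<in>index_sets k. g (x ` S)) \<in> C" using h by blast
    moreover have "(\<lambda>S\<in>index_sets k. g (x ` S)) = (\<lambda>S\<in>index_sets k. g (s ` S))"
    proof (rule restrict_ext)
      fix S assume "S \<in> index_sets k"
      then have "x ` S = s ` S" unfolding x_def by (intro image_cong) auto
      then show "g (x ` S) = g (s ` S)" by simp
    qed
    ultimately show "(\<lambda>S\<in>index_sets k. g (s ` S)) \<in> C" by simp
  qed
qed

text \<open>Disjointness passes from tuples to edges: an ordering of a common edge that lies in one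
  part also lies in the other by symmetry.\<close>

lemma hyperpartition_part_unique:
  assumes hp: "hyperpartition k l X P" and r: "r \<in> {1..k}"
    and "a \<in> {1..l}" "b \<in> {1..l}" "E \<in> edges r (P r a)" "E \<in> edges r (P r b)"
  shows "a = b"
proof (rule ccontr)
  assume "a \<noteq> b"
  then have disj: "P r a \<inter> P r b = {}"
    using hp r assms(3,4) unfolding hyperpartition_def disjoint_family_on_def by blast
  have ua: "uniform_hypergraph r X (P r a)" and ub: "uniform_hypergraph r X (P r b)"
    using hp r assms(3,4) unfolding hyperpartition_def by blast+
  obtain x where x: "x \<in> P r b" "E = x ` {1..r}" using assms(6) unfolding edges_def by blast
  then have "x \<in> distinct_tuples r X" using ub unfolding uniform_hypergraph_def by blast
  then have "x \<in> P r a" using image_in_edges_iff[OF ua] x(2) assms(5) by blast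
  then show False using x(1) disj by blast
qed

text \<open>Here \<open>g\<close> records the part containing each \<open>\<phi>\<close>
  T\<open>. For a tuple\<close>x\<open>of\<close>F\<open>, the image tuple therefore lies in one
  directed cell only, the one with coordinate\<close>S \<mapsto> g (x \<open>S)\<close>, and it is
  in the cell union iff that coordinate is in \<open>C\<close>.\<close>

lemma hom_iff_structure_hom:
  assumes hp: "hyperpartition k l X P" and C: "combinatorial_structure k l C"
    and finV: "finite V" and F: "uniform_hypergraph k V F"
    and g: "g \<in> small_subsets V k \<rightarrow>\<^sub>E {1..l}" and \<phi>: "\<phi> \<in> V \<rightarrow>\<^sub>E X"
    and col: "\<And>T. T \<in> small_subsets V k \<Longrightarrow> \<phi> ` T \<in> edges (card T) (P (card T) (g T))"
  shows "\<phi> \<in> homs k V F X (cell_union k X P C) \<longleftrightarrow> structure_hom k F C g"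
proof -
  have "compose {1..k} \<phi> x \<in> cell_union k X P C \<longleftrightarrow> (\<lambda>S\<in>index_sets k. g (x ` S)) \<in> C"
    if xF: "x \<in> F" for x
  proof -
    define y where "y = compose {1..k} \<phi> x"
    have x: "x \<in> {1..k} \<rightarrow>\<^sub>E V" "inj_on x {1..k}"
      using F xF unfolding uniform_hypergraph_def distinct_tuples_def by blast+
    have yS: "y ` S = \<phi> ` (x ` S)" if "S \<in> index_sets k" for S
      unfolding image_image y_def using that by (intro image_cong) (auto simp: compose_def)
    have xS: "x ` S \<in> small_subsets V k" "card (x ` S) = card S" "card S \<in> {1..k}"
      if S: "S \<in> index_sets k" for S
    proof -
      have sub: "S \<subseteq> {1..k}" "S \<noteq> {}" using S by blast+
      have "finite S" using finite_subset[OF sub(1)] by simp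
      show c: "card (x ` S) = card S"
        using inj_on_subset[OF x(2) sub(1)] by (rule card_image)
      have le: "card S \<le> k" using card_mono[OF _ sub(1)] by simp
      then show "card S \<in> {1..k}" using \<open>finite S\<close> sub(2) by (simp add: card_gt_0_iff Suc_le_eq)
      have "x ` S \<subseteq> V" using PiE_mem[OF x(1)] sub(1) by blast
      then show "x ` S \<in> small_subsets V k"
        using c le sub(2) unfolding small_subsets_def by simp
    qed
    have yP: "y ` S \<in> edges (card S) (P (card S) (g (x ` S)))" if "S \<in> index_sets k" for S
      using col[OF xS(1)[OF that]] yS[OF that] xS(2)[OF that] by simp
    have yE: "y \<in> {1..k} \<rightarrow>\<^sub>E X"
      unfolding y_def compose_def using PiE_mem[OF \<phi> PiE_mem[OF x(1)]]
      by (intro restrict_PiE_iff[THEN iffD2]) blast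
    \<comment> \<open>\<open>\<phi>\<close> need not be injective; distinctness of \<open>y\<close>
      comes from the colour of the full index set. For \<open>k = 0\<close> there is no such set,
      but the empty tuple is trivially distinct.\<close>
    have yK: "y \<in> distinct_tuples k X"
    proof (cases "k = 0")
      case True
      then show ?thesis using yE by (simp add: distinct_tuples_def)
    next
      case False
      then have full: "{1..k} \<in> index_sets k" by simp
      have "uniform_hypergraph k X (P k (g (x ` {1..k})))"
        using hp False PiE_mem[OF g xS(1)[OF full]] unfolding hyperpartition_def by simp
      moreover have "y ` {1..k} \<in> edges k (P k (g (x ` {1..k})))" using yP[OF full] by simp
      ultimately show ?thesis
        using image_in_edges_iff_mem[OF _ yE] unfolding uniform_hypergraph_def by blast
    qed
    have "y \<in> directed_cell k X P f \<longleftrightarrow> f = (\<lambda>S\<in>index_sets k. g (x ` S))" if f: "f \<in> C" for f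
    proof -
      have fE: "f \<in> index_sets k \<rightarrow>\<^sub>E {1..l}" using C f unfolding combinatorial_structure_def by blast
      have "y ` S \<in> edges (card S) (P (card S) (f S)) \<longleftrightarrow> f S = g (x ` S)" if S: "S \<in> index_sets k" for S
        using hyperpartition_part_unique[OF hp xS(3)[OF S] PiE_mem[OF fE S] PiE_mem[OF g xS(1)[OF S]] _ yP[OF S]]
          yP[OF S] by metis
      then have "y \<in> directed_cell k X P f \<longleftrightarrow> (\<forall>S\<in>index_sets k. f S = g (x ` S))"
        unfolding directed_cell_def using yK by blast
      \<comment> \<open>Members of \<open>C\<close> are extensional, so agreement on the index sets
        is equality of functions.\<close>
      also have "\<dots> \<longleftrightarrow> f = (\<lambda>S\<in>index_sets k. g (x ` S))"
      proof
        assume eq: "\<forall>S\<in>index_sets k. f S = g (x ` S)"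
        show "f = (\<lambda>S\<in>index_sets k. g (x ` S))"
        proof (rule extensionalityI)
          show "f \<in> extensional (index_sets k)" using fE unfolding PiE_def by blast
        qed (use eq in simp_all)
      qed simp
      finally show ?thesis .
    qed
    then show ?thesis unfolding cell_union_def y_def[symmetric] by blast
  qed
  then show ?thesis
    unfolding homs_def structure_hom_iff_tuples[OF F] using \<phi> by blast
qed

lemma injective_map_coloured:
  assumes hp: "hyperpartition k l X P" and finV: "finite V"
    and \<phi>: "\<phi> \<in> V \<rightarrow>\<^sub>E X" "inj_on \<phi> V"
  obtains g where "g \<in> small_subsets V k \<rightarrow>\<^sub>E {1..l}"
    "\<And>T. T \<in> small_subsets V k \<Longrightarrow> \<phi> ` T \<in> edges (card T) (P (card T) (g T))"
proof -
  have "\<exists>j\<in>{1..l}. \<phi> ` T \<in> edges (card T) (P (card T) j)" if "T \<in> small_subsets V k" for T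
  proof -
    have T: "T \<subseteq> V" "T \<noteq> {}" "card T \<le> k" using that unfolding small_subsets_def by blast+
    have finT: "finite T" using T(1) finV by (rule finite_subset)
    have "card T \<in> {1..k}" using T finT by (simp add: card_gt_0_iff Suc_le_eq)
    then have un: "(\<Union>j\<in>{1..l}. P (card T) j) = distinct_tuples (card T) X"
      using hp unfolding hyperpartition_def by blast
    have "\<phi> ` T \<subseteq> X" using PiE_mem[OF \<phi>(1)] T(1) by blast
    moreover have "card (\<phi> ` T) = card T" using inj_on_subset[OF \<phi>(2) T(1)] by (rule card_image)
    ultimately have "\<phi> ` T \<in> edges (card T) {y \<in> distinct_tuples (card T) X. True}"
      unfolding edges_of_set_property[of _ _ "\<lambda>_. True"] using finT by simp
    then obtain y where y: "y \<in> distinct_tuples (card T) X" "\<phi> ` T = y ` {1..card T}"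
      unfolding edges_def by blast
    then obtain j where "j \<in> {1..l}" "y \<in> P (card T) j" unfolding un[symmetric] by blast
    then show ?thesis unfolding y(2) edges_def by (intro bexI[of _ j] imageI)
  qed
  then have "\<forall>T\<in>small_subsets V k. \<exists>j. j \<in> {1..l} \<and> \<phi> ` T \<in> edges (card T) (P (card T) j)"
    unfolding Bex_def by (intro ballI)
  from bchoice[OF this] obtain h where h: "\<And>T. T \<in> small_subsets V k \<Longrightarrow>
      h T \<in> {1..l} \<and> \<phi> ` T \<in> edges (card T) (P (card T) (h T))"
    by (elim exE) blast
  show ?thesis
    by (rule that[of "restrict h (small_subsets V k)"]) (use h in \<open>simp_all add: Pi_iff\<close>)
qed

text \<open>The sets \<open>M g\<close> with \<open>g\<close> in \<open>Gs\<close> are disjoint,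
  consist of homomorphisms and contain all injective ones; \<open>N\<close> covers whatever is
  left.\<close>

lemma card_homs_bounds:
  fixes X :: "'a set" and V :: "'b set"
  assumes finX: "finite X" and hp: "hyperpartition k l X P" and C: "combinatorial_structure k l C"
    and finV: "finite V" and F: "uniform_hypergraph k V F"
  defines "Gs \<equiv> {g \<in> small_subsets V k \<rightarrow>\<^sub>E {1..l}. structure_hom k F C g}"
    and "M \<equiv> \<lambda>g. {\<phi> \<in> V \<rightarrow>\<^sub>E X. \<forall>T\<in>small_subsets V k. \<phi> ` T \<in> edges (card T) (P (card T) (g T))}"
    and "N \<equiv> {\<phi> \<in> V \<rightarrow>\<^sub>E X. \<not> inj_on \<phi> V}"
  shows "(\<Sum>g\<in>Gs. card (M g)) \<le> card (homs k V F X (cell_union k X P C))"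
    and "card (homs k V F X (cell_union k X P C)) \<le> (\<Sum>g\<in>Gs. card (M g)) + card N"
proof -
  let ?H = "homs k V F X (cell_union k X P C)"
  have fin: "finite (V \<rightarrow>\<^sub>E X)" using finV finX by (simp add: finite_PiE)
  have fin_small: "finite (small_subsets V k)"
    using finV unfolding small_subsets_def by simp
  have finG: "finite Gs" using fin_small unfolding Gs_def by (simp add: finite_PiE)
  have finM: "finite (M g)" for g using fin unfolding M_def by simp
  have finH: "finite ?H" using fin unfolding homs_def by simp
  have iff: "\<phi> \<in> ?H \<longleftrightarrow> structure_hom k F C g"
    if "g \<in> small_subsets V k \<rightarrow>\<^sub>E {1..l}" "\<phi> \<in> M g" for g \<phi>
    using hom_iff_structure_hom[OF hp C finV F that(1), of \<phi>] that(2) unfolding M_def by blast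
  have "M g \<inter> M h = {}" if "g \<in> Gs" "h \<in> Gs" "g \<noteq> h" for g h
  proof (rule ccontr)
    assume "M g \<inter> M h \<noteq> {}"
    then obtain \<phi> where \<phi>: "\<phi> \<in> M g" "\<phi> \<in> M h" by blast
    have gh: "g \<in> small_subsets V k \<rightarrow>\<^sub>E {1..l}" "h \<in> small_subsets V k \<rightarrow>\<^sub>E {1..l}"
      using that unfolding Gs_def by blast+
    have "g = h"
    proof (rule PiE_ext[OF gh])
      fix T assume T: "T \<in> small_subsets V k"
      then have "T \<subseteq> V" "T \<noteq> {}" "card T \<le> k" unfolding small_subsets_def by blast+
      moreover from this(1) finV have "finite T" by (rule finite_subset)
      ultimately have "card T \<in> {1..k}" by (simp add: card_gt_0_iff Suc_le_eq)
      moreover have "\<phi> ` T \<in> edges (card T) (P (card T) (g T))" "\<phi> ` T \<in> edges (card T) (P (card T) (h T))"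
        using \<phi> T unfolding M_def by simp_all
      ultimately show "g T = h T"
        by (rule hyperpartition_part_unique[OF hp _ PiE_mem[OF gh(1) T] PiE_mem[OF gh(2) T]])
    qed
    then show False using that(3) by blast
  qed
  then have cU: "card (\<Union>g\<in>Gs. M g) = (\<Sum>g\<in>Gs. card (M g))"
    using finG finM by (intro card_UN_disjoint) blast+
  have "(\<Union>g\<in>Gs. M g) \<subseteq> ?H" using iff unfolding Gs_def by blast
  then show "(\<Sum>g\<in>Gs. card (M g)) \<le> card ?H"
    unfolding cU[symmetric] by (rule card_mono[OF finH])
  have "?H \<subseteq> (\<Union>g\<in>Gs. M g) \<union> N"
  proof
    fix \<phi> assume \<phi>: "\<phi> \<in> ?H"
    then have \<phi>E: "\<phi> \<in> V \<rightarrow>\<^sub>E X" unfolding homs_def by blast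
    show "\<phi> \<in> (\<Union>g\<in>Gs. M g) \<union> N"
    proof (cases "inj_on \<phi> V")
      case True
      from injective_map_coloured[OF hp finV \<phi>E this]
      obtain g where g: "g \<in> small_subsets V k \<rightarrow>\<^sub>E {1..l}"
        and col: "\<And>T. T \<in> small_subsets V k \<Longrightarrow> \<phi> ` T \<in> edges (card T) (P (card T) (g T))" by metis
      have \<phi>M: "\<phi> \<in> M g" using \<phi>E col unfolding M_def by simp
      then have "g \<in> Gs" using iff[OF g \<phi>M] g \<phi> unfolding Gs_def by blast
      then show ?thesis using \<phi>M by blast
    qed (use \<phi>E in \<open>simp add: N_def\<close>)
  qed
  then have "card ?H \<le> card ((\<Union>g\<in>Gs. M g) \<union> N)"
    using finG finM fin unfolding N_def by (intro card_mono) simp_all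
  also have "\<dots> \<le> card (\<Union>g\<in>Gs. M g) + card N" by (rule card_Un_le)
  finally show "card ?H \<le> (\<Sum>g\<in>Gs. card (M g)) + card N" unfolding cU .
qed

section \<open>Convergence of the homomorphism densities\<close>

theorem mainTheorem8:
  fixes k l :: nat
    and U :: "nat \<Rightarrow> 'a set"
    and P :: "nat \<Rightarrow> nat \<Rightarrow> nat \<Rightarrow> (nat \<Rightarrow> 'a) set"
    and \<epsilon> \<delta> :: "nat \<Rightarrow> real"
    and C :: "(nat set \<Rightarrow> nat) set"
    and V :: "'b set"
    and F :: "(nat \<Rightarrow> 'b) set"
  assumes "\<And>i. finite (U i)"
    and "strict_mono (\<lambda>i. card (U i))"
    and "\<And>i. hyperpartition k l (U i) (P i)"
    and "\<And>i. regular_hyperpartition k l (U i) (\<epsilon> i) (P i)"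
    and "\<And>i. equitable k l (U i) (\<delta> i) (P i)"
    and "\<epsilon> \<longlonglongrightarrow> 0"
    and "\<delta> \<longlonglongrightarrow> 0"
    and "combinatorial_structure k l C"
    and "finite V"
    and "uniform_hypergraph k V F"
  shows "(\<lambda>i. hom_density k V F (U i) (cell_union k (U i) (P i) C))
           \<longlonglongrightarrow> structure_density k l V F C"
proof -
  have lim: "filterlim (\<lambda>i. card (U i)) at_top sequentially"
    using assms(2) by (rule filterlim_subseq)
  define Sm where "Sm = small_subsets V k"
  define Gs where "Gs = {g \<in> Sm \<rightarrow>\<^sub>E {1..l}. structure_hom k F C g}"
  define M where "M g i = {\<phi> \<in> V \<rightarrow>\<^sub>E U i. \<forall>T\<in>Sm. \<phi> ` T \<in> edges (card T) (P i (card T) (g T))}" for g i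
  define N where "N i = {\<phi> \<in> V \<rightarrow>\<^sub>E U i. \<not> inj_on \<phi> V}" for i
  define n where "n i = real (card (U i)) ^ card V" for i
  have finSm: "finite Sm" using assms(9) unfolding Sm_def small_subsets_def by simp
  \<comment> \<open>The uniform distribution requires a nonempty set of colourings. If
    \<open>k = 0\<close> there is nothing to colour; otherwise \<open>U 1\<close> has a point, since
    \<open>card (U 0) < card (U 1)\<close>, and some part must contain it, so \<open>l\<close> is
    positive.\<close>
  have "Sm \<rightarrow>\<^sub>E {1..l} \<noteq> {}"
  proof (cases "k = 0")
    case True
    then have "Sm = {}"
      using assms(9) finite_subset unfolding Sm_def small_subsets_def by fastforce
    then show ?thesis by simp
  next
    case False
    have "strict_mono (\<lambda>i. card (U i)) \<Longrightarrow> card (U 0) < card (U 1)" by (simp add: strict_mono_def)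
    then have "distinct_tuples 1 (U 1) \<noteq> {}"
      using distinct_tuples_nonempty[OF _ assms(1)] assms(2) by force
    moreover have "(\<Union>j\<in>{1..l}. P 1 1 j) = distinct_tuples 1 (U 1)"
      using assms(3)[of 1] False unfolding hyperpartition_def by simp
    ultimately show ?thesis by (auto simp: PiE_eq_empty_iff)
  qed
  moreover have "finite (Sm \<rightarrow>\<^sub>E {1..l})" using finSm by (simp add: finite_PiE)
  ultimately have "structure_density k l V F C
      = real (card ((Sm \<rightarrow>\<^sub>E {1..l}) \<inter> {g. structure_hom k F C g})) / real (card (Sm \<rightarrow>\<^sub>E {1..l}))"
    unfolding structure_density_def Sm_def by (rule measure_pmf_of_set)
  also have "(Sm \<rightarrow>\<^sub>E {1..l}) \<inter> {g. structure_hom k F C g} = Gs" unfolding Gs_def by blast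
  \<comment> \<open>The density is written as a sum over the colourings in \<open>Gs\<close>, each
    of probability \<open>(1 / l) ^ card Sm\<close>, to match the limits of the individual
    counts.\<close>
  also have "real (card Gs) / real (card (Sm \<rightarrow>\<^sub>E {1..l})) = (\<Sum>g\<in>Gs. (1 / real l) ^ card Sm)"
    using finSm by (simp add: card_funcsetE power_divide)
  finally have density: "structure_density k l V F C = (\<Sum>g\<in>Gs. (1 / real l) ^ card Sm)" .
  have "(\<lambda>i. real (card (M g i)) / n i) \<longlonglongrightarrow> (1 / real l) ^ card Sm" if "g \<in> Gs" for g
    unfolding M_def n_def
    by (rule cell_density_tendsto[OF assms(1) lim assms(3-7,9)])
      (use that finSm in \<open>auto simp: Gs_def Sm_def simp del: One_nat_def\<close>)
  then have lower: "(\<lambda>i. \<Sum>g\<in>Gs. real (card (M g i)) / n i) \<longlonglongrightarrow> structure_density k l V F C"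
    unfolding density by (rule tendsto_sum)
  have "(\<lambda>i. real (card (N i)) / n i) \<longlonglongrightarrow> 0"
    unfolding N_def n_def by (rule noninjective_negligible[OF assms(1,9) lim])
  from tendsto_add[OF lower this]
  have upper: "(\<lambda>i. (\<Sum>g\<in>Gs. real (card (M g i)) / n i) + real (card (N i)) / n i)
      \<longlonglongrightarrow> structure_density k l V F C" by simp
  note bounds = card_homs_bounds[OF assms(1,3,8,9,10), folded Sm_def, folded Gs_def M_def N_def]
  have n0: "0 \<le> n i" for i by (simp add: n_def)
  show ?thesis
  \<comment> \<open>The two bounds on the number of homomorphisms, divided by the number of all
    maps, differ by the vanishing share of non-injective maps.\<close>
  proof (rule tendsto_sandwich[OF _ _ lower upper]; intro always_eventually allI)
    fix i
    let ?H = "homs k V F (U i) (cell_union k (U i) (P i) C)"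
    show "(\<Sum>g\<in>Gs. real (card (M g i)) / n i) \<le> hom_density k V F (U i) (cell_union k (U i) (P i) C)"
    proof -
      have "(\<Sum>g\<in>Gs. real (card (M g i))) \<le> real (card ?H)"
        using bounds(1)[of i] unfolding of_nat_sum[symmetric] of_nat_le_iff .
      then show ?thesis
        unfolding hom_density_def n_def[symmetric] sum_divide_distrib[symmetric]
        by (rule divide_right_mono[OF _ n0])
    qed
    show "hom_density k V F (U i) (cell_union k (U i) (P i) C)
        \<le> (\<Sum>g\<in>Gs. real (card (M g i)) / n i) + real (card (N i)) / n i"
    proof -
      have "real (card ?H) \<le> (\<Sum>g\<in>Gs. real (card (M g i))) + real (card (N i))"
        using bounds(2)[of i] unfolding of_nat_sum[symmetric] of_nat_add[symmetric] of_nat_le_iff .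
      then show ?thesis
        unfolding hom_density_def n_def[symmetric] sum_divide_distrib[symmetric] add_divide_distrib[symmetric]
        by (rule divide_right_mono[OF _ n0])
    qed
  qed
qed

end
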